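(* Let $\psi:[0,\infty)\to[0,\infty)$ be non-decreasing and left-continuous, $n\ge1$, $\alpha\in(0,n)$. Let $X(\mathbb{R}^n)$ and $Y(\mathbb{R}^n)$ be quasi-normed rearrangement invariant function spaces with representation spaces $\overline X(0,\infty)$ and $\overline Y(0,\infty)$. Suppose that $\mathcal T_Y:Y(\mathbb{R}^n)\to[0,\infty)$, $\mathcal T_X:X(\mathbb{R}^n)\to[0,\infty)$, $\overline{\mathcal T}_{\overline Y}:\overline Y(0,\infty)\to[0,\infty)$, $\overline{\mathcal T}_{\overline X}:\overline X(0,\infty)\to[0,\infty)$ satisfy: (a) $\mathcal T_X(f_1)=\overline{\mathcal T}_{\overline X}(f_1^* )$ for $f_1\in X(\mathbb{R}^n)$ and $\mathcal T_Y(f_2)=\overline{\mathcal T}_{\overline Y}(f_2^* )$ for $f_2\in Y(\mathbb{R}^n)$; (b) $\overline{\mathcal T}_{\overline X}(\phi)=\overline{\mathcal T}_{\overline X}(\phi^* )$ for $0\le\phi\in\overline X(0,\infty)$ and $\overline{\mathcal T}_{\overline Y}(\phi)=\overline{\mathcal T}_{\overline Y}(\phi^* )$ for $0\le\phi\in\overline Y(0,\infty)$; (c) if $\phi_1,\phi_2\in\overline Y(0,\infty)$ and $0\le\phi_1\le\phi_2$, then $\overline{\mathcal T}_{\overline Y}(\phi_1)\le\overline{\mathcal T}_{\overline Y}(\phi_2)$. Let $\Omega\subseteq\mathbb{R}^n$ be a measurable set. Consider the assertions: (i) for every $k>0$ there exists a constant $c>0$ such that for every nonnegative $\phi\in\overline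 X(0,|\Omega|)$ $$\overline{\mathcal T}_{\overline Y}\left(k\int_t^\infty s^{\frac{\alpha}{n}-1}\psi\!\left(s^{\frac{\alpha}{n}-1}\int_0^s\phi(y)\,dy\right)ds\right)\le\overline{\mathcal T}_{\overline X}(c\phi)$$ (the argument on the left being a function of $t\in(0,\infty)$); (ii) for every $k>0$ there exists a constant $c>0$ such that for every $f\in X(\Omega)$ $$\mathcal T_Y(k\,\mathbf{W}_{\alpha,\psi}f)\le\mathcal T_X(cf).$$ Then (i) implies (ii). Moreover, if $\Omega=\mathbb{R}^n$, then also (ii) implies (i).
   Context: $\mathbf{W}_{\alpha,\psi}f(x):=\int_0^\infty r^{\alpha-1}\psi\big(r^{\alpha-n}\int_{B(x,r)}|f(y)|\,dy\big)dr$, $x\in\mathbb{R}^n$. $f^*(t):=\sup\{s\ge0:|\{|f|>s\}|>t\}$ is the decreasing rearrangement. $X(\Omega)$ denotes the functions on $\Omega$ whose extension by $0$ lies in $X(\mathbb{R}^n)$, and $\overline X(0,|\Omega|)$ the functions on $(0,|\Omega|)$ whose extension by $0$ lies in $\overline X(0,\infty)$; such functions are always extended by $0$. Throughout, the potential is only applied to measurable $f$ with $|\{x:|f(x)|>\tau\}|<\infty$ for all $\tau>0$. The inequalities in (i) and (ii) are understood to include the assertion that the arguments of $\overline{\mathcal T}_{\overline Y}$ and $\mathcal T_Y$ belong to $\overline Y(0,\infty)$ and $Y(\mathbb{R}^n)$, respectively. A quasi-normed function space $X(\mathbb{R}^n)$ is a linear space of measurable functions with a functional $\|\cdot\|$ such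 that: (1) $\|f\|>0$ if $f\ne0$, $\|\lambda f\|=|\lambda|\|f\|$, and $\|f+g\|\le c(\|f\|+\|g\|)$ for some constant $c\ge1$; (2) $0\le|g|\le|f|$ a.e. implies $\|g\|\le\|f\|$; (3) $0\le f_k\nearrow f$ a.e. implies $\|f_k\|\nearrow\|f\|$; (4) $\|\mathbf 1_E\|<\infty$ if $|E|<\infty$; (5) for every measurable $E$ with $|E|<\infty$ there is $C$ with $\int_E|f|\,dx\le C\|f\|$ for all $f$ in the space. It is rearrangement invariant if $\|f\|=\|g\|$ whenever $f,g$ are finite a.e. and $|\{|f|>t\}|=|\{|g|>t\}|$ for all $t>0$. Its representation space $\overline X(0,\infty)$ is the rearrangement invariant space on $(0,\infty)$ with $\|f\|_{X(\mathbb{R}^n)}=\|f^*\|_{\overline X(0,\infty)}$ for every $f\in X(\mathbb{R}^n)$.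
   Formalization: In (ii) all f in X(Ω) are admitted, also those with |{|f|>τ}|=∞ for some τ>0; if (ii) is restricted to f with finite level sets, (ii)⇒(i) fails for ψ=0 (e.g. X=Y=L^∞), while for ψ≠0 and Ω=R^n both versions of (ii) are equivalent. *)

theory Defs
  imports "HOL-Analysis.Analysis"
begin

(* A quasi-norm is a [0,\<infinity>]-valued functional on all measurable extended-real functions, and the
   space consists of the measurable functions at which it is finite.  Functions are not quotiented
   by a.e. equality; the lattice axiom makes the quasi-norm insensitive to null sets and to values
   outside "space M". *)

type_synonym 'a functional = "('a \<Rightarrow> ereal) \<Rightarrow> ennreal"

definition fun_space :: "'a measure \<Rightarrow> 'a functional \<Rightarrow> ('a \<Rightarrow> ereal) set" where
  "fun_space M N = {f \<in> borel_measurable M. N f < \<infinity>}"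

(* Elements of the space are finite a.e. by the last axiom, so the convention for \<infinity> - \<infinity> in the
   quasi-triangle inequality plays no role. *)
definition quasi_normed_function_space :: "'a measure \<Rightarrow> 'a functional \<Rightarrow> bool" where
  "quasi_normed_function_space M N \<longleftrightarrow>
     (\<forall>f\<in>borel_measurable M. \<not> (AE x in M. f x = 0) \<longrightarrow> 0 < N f) \<and>
     (\<forall>f\<in>borel_measurable M. \<forall>l::real. N (\<lambda>x. ereal l * f x) = ennreal \<bar>l\<bar> * N f) \<and>
     (\<exists>c::real. 1 \<le> c \<and>
        (\<forall>f\<in>borel_measurable M. \<forall>g\<in>borel_measurable M.
           N (\<lambda>x. f x + g x) \<le> ennreal c * (N f + N g))) \<and>
     (\<forall>f\<in>borel_measurable M. \<forall>g\<in>borel_measurable M.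
        (AE x in M. \<bar>g x\<bar> \<le> \<bar>f x\<bar>) \<longrightarrow> N g \<le> N f) \<and>
     (\<forall>F f. (\<forall>k::nat. F k \<in> borel_measurable M) \<longrightarrow> f \<in> borel_measurable M \<longrightarrow>
        (AE x in M. (\<forall>k. 0 \<le> F k x) \<and> incseq (\<lambda>k. F k x) \<and> (\<lambda>k. F k x) \<longlonglongrightarrow> f x) \<longrightarrow>
        incseq (\<lambda>k. N (F k)) \<and> (\<lambda>k. N (F k)) \<longlonglongrightarrow> N f) \<and>
     (\<forall>E\<in>sets M. emeasure M E < \<infinity> \<longrightarrow> N (indicator E) < \<infinity>) \<and>
     (\<forall>E\<in>sets M. emeasure M E < \<infinity> \<longrightarrow>
        (\<exists>C::real. \<forall>f\<in>fun_space M N. (\<integral>\<^sup>+x\<in>E. e2ennreal \<bar>f x\<bar> \<partial>M) \<le> ennreal C * N f))"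

definition rearrangement_invariant :: "'a measure \<Rightarrow> 'a functional \<Rightarrow> bool" where
  "rearrangement_invariant M N \<longleftrightarrow>
     (\<forall>f\<in>borel_measurable M. \<forall>g\<in>borel_measurable M.
        (AE x in M. \<bar>f x\<bar> < \<infinity>) \<longrightarrow> (AE x in M. \<bar>g x\<bar> < \<infinity>) \<longrightarrow>
        (\<forall>t>0. emeasure M {x \<in> space M. ereal t < \<bar>f x\<bar>} = emeasure M {x \<in> space M. ereal t < \<bar>g x\<bar>})
        \<longrightarrow> N f = N g)"

definition ri_space :: "'a measure \<Rightarrow> 'a functional \<Rightarrow> bool" where
  "ri_space M N \<longleftrightarrow> quasi_normed_function_space M N \<and> rearrangement_invariant M N"

(* The supremum is taken in ennreal, so that it is 0 (not -\<infinity>) over the empty set.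
   Only the values at t > 0 matter. *)
definition rearr :: "'a measure \<Rightarrow> ('a \<Rightarrow> ereal) \<Rightarrow> real \<Rightarrow> ereal" where
  "rearr M f t =
     enn2ereal (Sup {s::ennreal. ennreal t < emeasure M {x \<in> space M. enn2ereal s < \<bar>f x\<bar>}})"

abbreviation half_line :: "real measure" where
  "half_line \<equiv> lebesgue_on {0<..}"

definition representation_space ::
    "(real^'n) functional \<Rightarrow> real functional \<Rightarrow> bool" where
  "representation_space N Nb \<longleftrightarrow>
     ri_space half_line Nb \<and> (\<forall>f\<in>fun_space lebesgue N. N f = Nb (rearr lebesgue f))"

(* Functions on A are identified with their extensions by 0. *)
definition fun_space_on :: "'a measure \<Rightarrow> 'a functional \<Rightarrow> 'a set \<Rightarrow> ('a \<Rightarrow> ereal) set" where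
  "fun_space_on M N A = {f \<in> fun_space M N. \<forall>x\<in>space M - A. f x = 0}"

(* In the next two definitions enn2real sends \<infinity> to 0, but the inner integrals are finite for all
   f and \<phi> belonging to a quasi-normed function space. *)
definition wolff_potential :: "real \<Rightarrow> (real \<Rightarrow> real) \<Rightarrow> (real^'n \<Rightarrow> ereal) \<Rightarrow> real^'n \<Rightarrow> ennreal" where
  "wolff_potential \<alpha> \<psi> f x =
     (\<integral>\<^sup>+r\<in>{0<..}. ennreal (r powr (\<alpha> - 1) *
        \<psi> (r powr (\<alpha> - real CARD('n)) * enn2real (\<integral>\<^sup>+y\<in>ball x r. e2ennreal \<bar>f y\<bar> \<partial>lebesgue)))
      \<partial>lebesgue)"

definition hardy_operator :: "real \<Rightarrow> (real \<Rightarrow> real) \<Rightarrow> (real \<Rightarrow> ereal) \<Rightarrow> real \<Rightarrow> ennreal" where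
  "hardy_operator \<beta> \<psi> \<phi> t =
     (\<integral>\<^sup>+s\<in>{t<..}. ennreal (s powr (\<beta> - 1) *
        \<psi> (s powr (\<beta> - 1) * enn2real (\<integral>\<^sup>+y\<in>{0<..<s}. e2ennreal (\<phi> y) \<partial>lebesgue)))
      \<partial>lebesgue)"

definition hardy_inequality ::
    "real \<Rightarrow> (real \<Rightarrow> real) \<Rightarrow> real functional \<Rightarrow> real functional \<Rightarrow>
     ((real \<Rightarrow> ereal) \<Rightarrow> real) \<Rightarrow> ((real \<Rightarrow> ereal) \<Rightarrow> real) \<Rightarrow> (real^'n) set \<Rightarrow> bool" where
  "hardy_inequality \<alpha> \<psi> NXb NYb TXb TYb \<Omega> \<longleftrightarrow>
     (\<forall>k::real. 0 < k \<longrightarrow> (\<exists>c::real. 0 < c \<and>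
        (\<forall>\<phi>\<in>fun_space_on half_line NXb {t. 0 < t \<and> ennreal t < emeasure lebesgue \<Omega>}.
           (\<forall>t>0. 0 \<le> \<phi> t) \<longrightarrow>
           (let u = (\<lambda>t. ereal k * enn2ereal (hardy_operator (\<alpha> / real CARD('n)) \<psi> \<phi> t)) in
              u \<in> fun_space half_line NYb \<and> TYb u \<le> TXb (\<lambda>t. ereal c * \<phi> t)))))"

(* All f in X(\<Omega>) are admitted, including those having level sets {|f| > \<tau>} of infinite measure;
   the potential is well defined for these too.  On \<Omega> = UNIV, excluding them changes the
   inequality only when \<psi> vanishes on {0..}: otherwise either there are no such f, or the space
   contains all bounded functions and the potential of a slowly decaying one is \<infinity> everywhere. *)
definition potential_inequality ::
    "real \<Rightarrow> (real \<Rightarrow> real) \<Rightarrow> (real^'n) functional \<Rightarrow> (real^'n) functional \<Rightarrow>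
     ((real^'n \<Rightarrow> ereal) \<Rightarrow> real) \<Rightarrow> ((real^'n \<Rightarrow> ereal) \<Rightarrow> real) \<Rightarrow> (real^'n) set \<Rightarrow> bool" where
  "potential_inequality \<alpha> \<psi> NX NY TX TY \<Omega> \<longleftrightarrow>
     (\<forall>k::real. 0 < k \<longrightarrow> (\<exists>c::real. 0 < c \<and>
        (\<forall>f\<in>fun_space_on lebesgue NX \<Omega>.
           (let u = (\<lambda>x. ereal k * enn2ereal (wolff_potential \<alpha> \<psi> f x)) in
              u \<in> fun_space lebesgue NY \<and> TY u \<le> TX (\<lambda>x. ereal c * f x)))))"

end

(* The potential is compared with the Hardy operator pointwise after rearranging.
   Given t > 0, split the radii at R with |B(0,R)| = t.  For r > R the mass of f in B(x,r) is at
   most the integral of f* over (0,|B(x,r)|), and substituting s = |B(x,r)| yields the Hardy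
   operator at t, up to constants inside and outside psi.  For r <= R, write |f| <= f*(t) + g with
   g = |f| on {|f| > f*(t)}; by a Vitali covering, outside a set of measure at most t the mean of
   |f| over B(x,r) is at most a multiple of (1/t) int_0^t f*, and monotonicity of psi absorbs that
   part into the Hardy integral over (t,2t).  Hence (W f)*(t) is at most a multiple of the Hardy
   operator of a multiple of f*.
   Conversely, for f(x) = phi*(|B(0,|x|)|) the inclusion of B(0,r/2) in B(x,r) for r > 2|x| bounds
   W f(x) from below by the Hardy operator of phi* at |B(0,|x|)|. *)

theory Submission
  imports Defs
begin

section \<open>Distribution functions and rearrangements\<close>

definition distrib :: "'a measure \<Rightarrow> ('a \<Rightarrow> ereal) \<Rightarrow> ennreal \<Rightarrow> ennreal" where
  "distrib M f s = emeasure M {x \<in> space M. enn2ereal s < \<bar>f x\<bar>}"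

lemma enn2ereal_less_abs_iff: "enn2ereal s < \<bar>y\<bar> \<longleftrightarrow> s < e2ennreal \<bar>y\<bar>"
  by (simp add: less_ennreal.rep_eq enn2ereal_e2ennreal)

lemma distrib_alt: "distrib M f s = emeasure M {x \<in> space M. s < e2ennreal \<bar>f x\<bar>}"
  by (simp add: distrib_def enn2ereal_less_abs_iff)

lemma rearr_alt: "rearr M f t = enn2ereal (Sup {s. ennreal t < distrib M f s})"
  by (simp add: rearr_def distrib_def)

lemma rearr_nonneg [simp]: "0 \<le> rearr M f t"
  by (simp add: rearr_def)

lemma abs_rearr [simp]: "\<bar>rearr M f t\<bar> = rearr M f t"
  by simp

lemma sets_level [measurable (raw)]:
  "f \<in> borel_measurable M \<Longrightarrow> {x \<in> space M. enn2ereal s < \<bar>f x\<bar>} \<in> sets M"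
  by measurable

lemma distrib_mono:
  assumes "g \<in> borel_measurable M" "AE x in M. \<bar>f x\<bar> \<le> \<bar>g x\<bar>"
  shows "distrib M f s \<le> distrib M g s"
  unfolding distrib_def
  using assms by (intro emeasure_mono_AE) (auto elim!: eventually_mono intro!: sets_level)

lemma rearr_mono:
  "(\<And>s. distrib M f s \<le> distrib N g s) \<Longrightarrow> rearr M f t \<le> rearr N g t"
  unfolding rearr_alt less_eq_ennreal.rep_eq[symmetric]
  by (intro Sup_subset_mono) (auto intro: less_le_trans)

lemma rearr_cong: "(\<And>s. distrib M f s = distrib N g s) \<Longrightarrow> rearr M f = rearr N g"
  by (simp add: rearr_alt fun_eq_iff)

lemma rearr_antimono: "t \<le> t' \<Longrightarrow> rearr M f t' \<le> rearr M f t"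
  unfolding rearr_alt less_eq_ennreal.rep_eq[symmetric]
  by (intro Sup_subset_mono) (auto intro: le_less_trans ennreal_leI)

lemma distrib_SUP:
  assumes "\<And>k. F k \<in> borel_measurable M" "\<And>x. incseq (\<lambda>k. \<bar>F k x\<bar>)"
    "\<And>x. x \<in> space M \<Longrightarrow> (\<lambda>k. \<bar>F k x\<bar>) \<longlonglongrightarrow> \<bar>f x\<bar>"
  shows "distrib M f s = (SUP k. distrib M (F k) s)"
proof -
  have "{x \<in> space M. enn2ereal s < \<bar>f x\<bar>} = (\<Union>k. {x \<in> space M. enn2ereal s < \<bar>F k x\<bar>})"
  proof (intro set_eqI iffI)
    fix x assume x: "x \<in> {x \<in> space M. enn2ereal s < \<bar>f x\<bar>}"
    then have "eventually (\<lambda>k. enn2ereal s < \<bar>F k x\<bar>) sequentially"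
      using assms(3)[of x] by (intro order_tendstoD(1)) auto
    with x show "x \<in> (\<Union>k. {x \<in> space M. enn2ereal s < \<bar>F k x\<bar>})"
      by (auto simp: eventually_sequentially)
  next
    fix x assume "x \<in> (\<Union>k. {x \<in> space M. enn2ereal s < \<bar>F k x\<bar>})"
    then obtain k where "x \<in> space M" "enn2ereal s < \<bar>F k x\<bar>" by auto
    moreover have "\<bar>F k x\<bar> \<le> \<bar>f x\<bar>"
      using assms(2)[of x] assms(3)[OF \<open>x \<in> space M\<close>] by (rule incseq_le)
    ultimately show "x \<in> {x \<in> space M. enn2ereal s < \<bar>f x\<bar>}" by auto
  qed
  moreover have "incseq (\<lambda>k. {x \<in> space M. enn2ereal s < \<bar>F k x\<bar>})"
  proof (intro monoI subsetI)
    fix k l x assume "k \<le> (l::nat)" "x \<in> {x \<in> space M. enn2ereal s < \<bar>F k x\<bar>}"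
    with incseqD[OF assms(2), of k l x] show "x \<in> {x \<in> space M. enn2ereal s < \<bar>F l x\<bar>}"
      by auto
  qed
  ultimately show ?thesis
    unfolding distrib_def using assms(1)
    by (subst SUP_emeasure_incseq) (auto simp: image_subset_iff intro!: sets_level)
qed

lemma less_rearr_iff:
  assumes f: "f \<in> borel_measurable M"
  shows "enn2ereal s < rearr M f t \<longleftrightarrow> ennreal t < distrib M f s"
proof
  assume "enn2ereal s < rearr M f t"
  then obtain s' where s': "s < s'" "ennreal t < distrib M f s'"
    by (auto simp: rearr_alt less_ennreal.rep_eq[symmetric] less_Sup_iff)
  have "distrib M f s' \<le> distrib M f s"
    unfolding distrib_alt using f s'(1)
    by (intro emeasure_mono) auto
  with s' show "ennreal t < distrib M f s" by simp
next
  assume t: "ennreal t < distrib M f s"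
  define u where "u n = s + ennreal (inverse (Suc n))" for n
  have u: "u \<longlonglongrightarrow> s"
  proof -
    have "u \<longlonglongrightarrow> s + ennreal 0" unfolding u_def
      by (intro tendsto_add tendsto_ennrealI tendsto_const LIMSEQ_inverse_real_of_nat)
    then show ?thesis by simp
  qed
  have dec: "u n \<le> u m" if "m \<le> n" for m n
    unfolding u_def using that by (intro add_left_mono ennreal_leI) (auto simp: field_simps)
  have "s \<noteq> top"
    using t by (auto simp: distrib_alt)
  then have su: "s < u n" for n
    unfolding u_def using ennreal_add_left_cancel_less[of s 0] by (simp add: less_top)
  have eq: "{x \<in> space M. s < e2ennreal \<bar>f x\<bar>} = (\<Union>n. {x \<in> space M. u n < e2ennreal \<bar>f x\<bar>})"
    using su less_trans order_tendstoD(2)[OF u]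
    by (auto simp: eventually_sequentially) blast
  have inc: "incseq (\<lambda>n. {x \<in> space M. u n < e2ennreal \<bar>f x\<bar>})"
    using dec by (fastforce simp: incseq_def intro: le_less_trans)
  have "distrib M f s = (SUP n. distrib M f (u n))"
    unfolding distrib_alt eq using f inc
    by (subst SUP_emeasure_incseq) auto
  with t obtain n where "ennreal t < distrib M f (u n)" by (auto simp: less_SUP_iff)
  then show "enn2ereal s < rearr M f t"
    using su[of n] by (auto simp: rearr_alt less_ennreal.rep_eq[symmetric] less_Sup_iff)
qed

lemma ennreal_eq_topI:
  assumes "\<And>m. ennreal (real m) \<le> x"
  shows "x = top"
proof (cases x)
  case (real r)
  with assms obtain m where "r < real m" "ennreal (real m) \<le> ennreal r"
    using reals_Archimedean2 by blast
  then show ?thesis using real by (simp add: ennreal_le_iff)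
qed

lemma emeasure_initial_segment:
  "{t. 0 < t \<and> ennreal t < a} \<in> sets borel"
  "emeasure lebesgue {t. 0 < t \<and> ennreal t < a} = a"
proof -
  show *: "{t. 0 < t \<and> ennreal t < a} \<in> sets borel" by measurable
  show "emeasure lebesgue {t. 0 < t \<and> ennreal t < a} = a"
  proof (cases a)
    case (real r)
    then have "{t. 0 < t \<and> ennreal t < a} = {0<..<r}"
      by (auto simp: ennreal_less_iff)
    with real show ?thesis by simp
  next
    case top
    then have "{t. 0 < t \<and> ennreal t < a} = {0<..}" by auto
    moreover have "emeasure lborel {0::real<..} = top"
    proof -
      have "ennreal n \<le> emeasure lborel {0::real<..}" for n :: nat
        using emeasure_mono[of "{0<..<real n}" "{0<..}" lborel] by (simp add: subset_eq)
      then show ?thesis by (rule ennreal_eq_topI)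
    qed
    ultimately show ?thesis using top by (simp)
  qed
qed

lemma borel_measurable_rearr [measurable]:
  assumes "f \<in> borel_measurable M"
  shows "rearr M f \<in> borel_measurable borel"
proof (rule borel_measurableI_greater)
  fix y :: ereal
  show "{x \<in> space borel. y < rearr M f x} \<in> sets borel"
  proof (cases "y < 0")
    case True
    then have "{x \<in> space borel. y < rearr M f x} = UNIV"
      using less_le_trans[OF True rearr_nonneg] by auto
    then show ?thesis by simp
  next
    case False
    then have "{x \<in> space borel. y < rearr M f x} = {x. ennreal x < distrib M f (e2ennreal y)}"
      using less_rearr_iff[OF assms, of "e2ennreal y"] by (simp add: enn2ereal_e2ennreal)
    also have "\<dots> \<in> sets borel" by measurable
    finally show ?thesis .
  qed
qed

lemma borel_measurable_half_line:
  assumes "f \<in> borel_measurable borel"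
  shows "f \<in> borel_measurable half_line"
  using assms by (intro measurable_restrict_space1 measurable_completion) simp

lemma distrib_half_line:
  "distrib half_line f s = emeasure lebesgue {t. 0 < t \<and> enn2ereal s < \<bar>f t\<bar>}"
  unfolding distrib_def by (subst emeasure_restrict_space) (auto intro!: arg_cong2[where f=emeasure])

lemma distrib_rearr:
  assumes "f \<in> borel_measurable M"
  shows "distrib half_line (rearr M f) = distrib M f"
  unfolding distrib_half_line
  using emeasure_initial_segment(2) by (simp add: less_rearr_iff[OF assms] fun_eq_iff)

lemma enn2ereal_less_scale_iff:
  assumes "0 < c"
  shows "enn2ereal s < \<bar>ereal c * y\<bar> \<longleftrightarrow> enn2ereal (s / ennreal c) < \<bar>y\<bar>"
proof -
  have "\<bar>ereal c * y\<bar> = enn2ereal (ennreal c * e2ennreal \<bar>y\<bar>)"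
    using assms by (simp add: ereal_abs_mult times_ennreal.rep_eq enn2ereal_e2ennreal)
  then have "enn2ereal s < \<bar>ereal c * y\<bar> \<longleftrightarrow> s < ennreal c * e2ennreal \<bar>y\<bar>"
    by (simp add: less_ennreal.rep_eq)
  also have "\<dots> \<longleftrightarrow> s / ennreal c < e2ennreal \<bar>y\<bar>"
    using assms by (subst mult.commute) (simp add: divide_less_ennreal)
  finally show ?thesis by (simp add: enn2ereal_less_abs_iff)
qed

lemma rearr_scale:
  assumes f: "f \<in> borel_measurable M" and c: "0 < c"
  shows "rearr M (\<lambda>x. ereal c * f x) = (\<lambda>t. ereal c * rearr M f t)"
proof
  fix t
  let ?L = "rearr M (\<lambda>x. ereal c * f x) t" and ?R = "\<bar>ereal c * rearr M f t\<bar>"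
  have *: "enn2ereal s < ?L \<longleftrightarrow> enn2ereal s < ?R" for s
  proof -
    have "enn2ereal s < ?L \<longleftrightarrow> ennreal t < distrib M (\<lambda>x. ereal c * f x) s"
      using f by (intro less_rearr_iff) auto
    also have "\<dots> \<longleftrightarrow> enn2ereal (s / ennreal c) < rearr M f t"
      by (simp add: distrib_def enn2ereal_less_scale_iff[OF c] less_rearr_iff[OF f])
    also have "\<dots> \<longleftrightarrow> enn2ereal s < ?R"
      by (subst enn2ereal_less_scale_iff[OF c]) simp
    finally show ?thesis .
  qed
  have "?L = ?R"
    using *[of "e2ennreal ?R"] *[of "e2ennreal ?L"]
    by (cases "?L < ?R"; cases "?R < ?L") (auto simp: enn2ereal_e2ennreal)
  also have "?R = ereal c * rearr M f t"
    using c by (simp add: ereal_abs_mult)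
  finally show "?L = ereal c * rearr M f t" .
qed

lemma sigma_finite_lebesgue: "sigma_finite_measure (lebesgue :: 'a::euclidean_space measure)"
proof -
  obtain A :: "nat \<Rightarrow> 'a set" where A: "range A \<subseteq> sets lborel" "(\<Union>i. A i) = space lborel"
    "\<And>i. emeasure lborel (A i) \<noteq> \<infinity>"
    using lborel.sigma_finite by blast
  show ?thesis
    using A by (intro sigma_finite_measure.intro exI[of _ "range A"]) auto
qed

lemma sigma_finite_half_line: "sigma_finite_measure half_line"
  by (intro sigma_finite_measure_restrict_space sigma_finite_lebesgue) simp

lemma layer_cake:
  assumes "sigma_finite_measure M" and g [measurable]: "g \<in> borel_measurable M"
  shows "(\<integral>\<^sup>+x. g x \<partial>M) = (\<integral>\<^sup>+s\<in>{0<..}. emeasure M {x \<in> space M. ennreal s < g x} \<partial>lborel)"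
proof -
  interpret pair_sigma_finite M lborel
    using assms by (simp add: pair_sigma_finite_def lborel.sigma_finite_measure_axioms)
  let ?h = "\<lambda>x s. indicator {s. 0 < s \<and> ennreal s < g x} s :: ennreal"
  have [measurable]: "case_prod ?h \<in> borel_measurable (M \<Otimes>\<^sub>M lborel)"
  proof -
    have "{z \<in> space (M \<Otimes>\<^sub>M lborel). 0 < snd z \<and> ennreal (snd z) < g (fst z)} \<in> sets (M \<Otimes>\<^sub>M lborel)"
      by measurable
    then have "(indicator {z \<in> space (M \<Otimes>\<^sub>M lborel). 0 < snd z \<and> ennreal (snd z) < g (fst z)} :: _ \<Rightarrow> ennreal)
        \<in> borel_measurable (M \<Otimes>\<^sub>M lborel)"
      by simp
    then show ?thesis
      by (rule measurable_cong[THEN iffD1, rotated]) (auto simp: space_pair_measure split: split_indicator)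
  qed
  have "(\<integral>\<^sup>+x. g x \<partial>M) = (\<integral>\<^sup>+x. (\<integral>\<^sup>+s. ?h x s \<partial>lborel) \<partial>M)"
    using emeasure_initial_segment by (simp add: emeasure_completion)
  also have "\<dots> = (\<integral>\<^sup>+s. (\<integral>\<^sup>+x. ?h x s \<partial>M) \<partial>lborel)"
    by (rule Fubini'[symmetric]) measurable
  also have "\<dots> = (\<integral>\<^sup>+s\<in>{0<..}. emeasure M {x \<in> space M. ennreal s < g x} \<partial>lborel)"
  proof (rule nn_integral_cong)
    fix s :: real
    have "(\<integral>\<^sup>+x. ?h x s \<partial>M) = (\<integral>\<^sup>+x. indicator {x \<in> space M. ennreal s < g x} x * indicator {0<..} s \<partial>M)"
      by (intro nn_integral_cong) (auto split: split_indicator)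
    also have "\<dots> = emeasure M {x \<in> space M. ennreal s < g x} * indicator {0<..} s"
      by (subst nn_integral_multc) (auto)
    finally show "(\<integral>\<^sup>+x. ?h x s \<partial>M) = emeasure M {x \<in> space M. ennreal s < g x} * indicator {0<..} s" .
  qed
  finally show ?thesis .
qed

lemma nn_integral_rearr:
  assumes f: "f \<in> borel_measurable M"
  shows "(\<integral>\<^sup>+t\<in>{0<..<a}. e2ennreal (rearr M f t) \<partial>lebesgue) =
    (\<integral>\<^sup>+s\<in>{0<..}. min (ennreal a) (distrib M f (ennreal s)) \<partial>lborel)"
proof -
  note [measurable] = borel_measurable_rearr[OF f]
  have "(\<integral>\<^sup>+t\<in>{0<..<a}. e2ennreal (rearr M f t) \<partial>lebesgue) =
    (\<integral>\<^sup>+t. e2ennreal (rearr M f t) * indicator {0<..<a} t \<partial>lborel)"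
    by (rule nn_integral_completion)
  also have "\<dots> = (\<integral>\<^sup>+s\<in>{0<..}. emeasure lborel {t \<in> space lborel. ennreal s <
       e2ennreal (rearr M f t) * indicator {0<..<a} t} \<partial>lborel)"
    by (intro layer_cake lborel.sigma_finite_measure_axioms) measurable
  also have "\<dots> = (\<integral>\<^sup>+s\<in>{0<..}. min (ennreal a) (distrib M f (ennreal s)) \<partial>lborel)"
  proof (intro nn_integral_cong)
    fix s :: real
    have "{t \<in> space lborel. ennreal s < e2ennreal (rearr M f t) * indicator {0<..<a} t} =
      {t. 0 < t \<and> ennreal t < min (ennreal a) (distrib M f (ennreal s))}"
      using less_rearr_iff[OF f, of "ennreal s"] enn2ereal_less_abs_iff[of "ennreal s" "rearr M f _"]
      by (auto split: split_indicator simp: ennreal_less_iff)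
    moreover have "emeasure lborel {t. 0 < t \<and> ennreal t < b} = b" for b
      using emeasure_initial_segment by (simp add: emeasure_completion)
    ultimately show "emeasure lborel {t \<in> space lborel. ennreal s <
       e2ennreal (rearr M f t) * indicator {0<..<a} t} * indicator {0<..} s =
       min (ennreal a) (distrib M f (ennreal s)) * indicator {0<..} s"
      by (simp only:)
  qed
  finally show ?thesis .
qed

lemma nn_integral_le_rearr:
  assumes M: "sigma_finite_measure M" and f [measurable]: "f \<in> borel_measurable M"
    and [measurable]: "E \<in> sets M" and E: "emeasure M E \<le> ennreal a"
  shows "(\<integral>\<^sup>+x\<in>E. e2ennreal \<bar>f x\<bar> \<partial>M) \<le> (\<integral>\<^sup>+t\<in>{0<..<a}. e2ennreal (rearr M f t) \<partial>lebesgue)"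
proof -
  have "(\<integral>\<^sup>+x\<in>E. e2ennreal \<bar>f x\<bar> \<partial>M) =
    (\<integral>\<^sup>+s\<in>{0<..}. emeasure M {x \<in> space M. ennreal s < e2ennreal \<bar>f x\<bar> * indicator E x} \<partial>lborel)"
    by (intro layer_cake M) measurable
  also have "\<dots> \<le> (\<integral>\<^sup>+s\<in>{0<..}. min (ennreal a) (distrib M f (ennreal s)) \<partial>lborel)"
  proof (intro nn_integral_mono mult_right_mono min.boundedI)
    fix s :: real
    let ?S = "{x \<in> space M. ennreal s < e2ennreal \<bar>f x\<bar> * indicator E x}"
    have "emeasure M ?S \<le> emeasure M E"
      by (intro emeasure_mono) (auto split: split_indicator_asm)
    with E show "emeasure M ?S \<le> ennreal a" by simp
    show "emeasure M ?S \<le> distrib M f (ennreal s)"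
      unfolding distrib_alt by (intro emeasure_mono) (auto split: split_indicator_asm)
  qed simp
  finally show ?thesis by (simp add: nn_integral_rearr[OF f])
qed

section \<open>Quasi-norms of rearrangements\<close>

lemma quasi_normD:
  assumes "quasi_normed_function_space M N"
  shows quasi_norm_scale: "\<And>f l. f \<in> borel_measurable M \<Longrightarrow> N (\<lambda>x. ereal l * f x) = ennreal \<bar>l\<bar> * N f"
    and quasi_norm_mono: "\<And>f g. f \<in> borel_measurable M \<Longrightarrow> g \<in> borel_measurable M \<Longrightarrow>
          (AE x in M. \<bar>g x\<bar> \<le> \<bar>f x\<bar>) \<Longrightarrow> N g \<le> N f"
    and quasi_norm_tendsto: "\<And>F f. (\<And>k::nat. F k \<in> borel_measurable M) \<Longrightarrow> f \<in> borel_measurable M \<Longrightarrow>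
          (AE x in M. (\<forall>k. 0 \<le> F k x) \<and> incseq (\<lambda>k. F k x) \<and> (\<lambda>k. F k x) \<longlonglongrightarrow> f x) \<Longrightarrow>
          (\<lambda>k. N (F k)) \<longlonglongrightarrow> N f"
    and quasi_norm_indicator: "\<And>E. E \<in> sets M \<Longrightarrow> emeasure M E < \<infinity> \<Longrightarrow> N (indicator E) < \<infinity>"
    and quasi_norm_integral: "\<And>E f. E \<in> sets M \<Longrightarrow> emeasure M E < \<infinity> \<Longrightarrow> f \<in> fun_space M N \<Longrightarrow>
          (\<integral>\<^sup>+x\<in>E. e2ennreal \<bar>f x\<bar> \<partial>M) < \<infinity>"
proof -
  note A = assms[unfolded quasi_normed_function_space_def]
  show "\<And>f l. f \<in> borel_measurable M \<Longrightarrow> N (\<lambda>x. ereal l * f x) = ennreal \<bar>l\<bar> * N f"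
    using A by blast
  show "\<And>f g. f \<in> borel_measurable M \<Longrightarrow> g \<in> borel_measurable M \<Longrightarrow>
          (AE x in M. \<bar>g x\<bar> \<le> \<bar>f x\<bar>) \<Longrightarrow> N g \<le> N f"
    using A by blast
  show "\<And>F f. (\<And>k::nat. F k \<in> borel_measurable M) \<Longrightarrow> f \<in> borel_measurable M \<Longrightarrow>
          (AE x in M. (\<forall>k. 0 \<le> F k x) \<and> incseq (\<lambda>k. F k x) \<and> (\<lambda>k. F k x) \<longlonglongrightarrow> f x) \<Longrightarrow>
          (\<lambda>k. N (F k)) \<longlonglongrightarrow> N f"
    using A by blast
  show "\<And>E. E \<in> sets M \<Longrightarrow> emeasure M E < \<infinity> \<Longrightarrow> N (indicator E) < \<infinity>"
    using A by blast
  fix E f assume *: "E \<in> sets M" "emeasure M E < \<infinity>" "f \<in> fun_space M N"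
  then obtain C :: real where "(\<integral>\<^sup>+x\<in>E. e2ennreal \<bar>f x\<bar> \<partial>M) \<le> ennreal C * N f"
    using A by blast
  moreover have "ennreal C * N f < \<infinity>"
    using *(3) by (auto simp: fun_space_def ennreal_mult_less_top)
  ultimately show "(\<integral>\<^sup>+x\<in>E. e2ennreal \<bar>f x\<bar> \<partial>M) < \<infinity>" by (rule le_less_trans)
qed

text \<open>Truncation reduces the identity to bounded functions supported on sets of finite measure,
  which lie in every quasi-normed function space.\<close>

lemma norm_rearr:
  assumes M: "sigma_finite_measure M"
    and N: "quasi_normed_function_space M N" and Nb: "quasi_normed_function_space half_line Nb"
    and eq: "\<And>g c. g \<in> fun_space M N \<Longrightarrow> (\<And>x. \<bar>g x\<bar> \<le> ereal c) \<Longrightarrow> N g = Nb (rearr M g)"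
    and f: "f \<in> borel_measurable M"
  shows "Nb (rearr M f) = N f"
proof -
  interpret sigma_finite_measure M by (rule M)
  note [measurable] = f
  obtain A :: "nat \<Rightarrow> _" where A: "range A \<subseteq> sets M" "(\<Union>i. A i) = space M"
      "\<And>i. emeasure M (A i) \<noteq> \<infinity>" "incseq A"
    using sigma_finite_incseq by metis
  then have [measurable]: "\<And>k. A k \<in> sets M" by auto
  define F where "F k x = min \<bar>f x\<bar> (ereal (real k)) * indicator (A k) x" for k x
  have F_meas [measurable]: "F k \<in> borel_measurable M" for k
    unfolding F_def by measurable
  have F0: "0 \<le> F k x" for k x
    by (auto simp: F_def split: split_indicator)
  then have absF [simp]: "\<bar>F k x\<bar> = F k x" for k x by simp
  have F_inc: "incseq (\<lambda>k. F k x)" for x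
  proof (rule incseq_SucI)
    fix k
    have "indicator (A k) x \<le> (indicator (A (Suc k)) x :: ereal)"
      using incseq_SucD[OF A(4), of k] by (auto split: split_indicator)
    then show "F k x \<le> F (Suc k) x"
      unfolding F_def by (intro ereal_mult_mono min.mono) auto
  qed
  have F_lim: "(\<lambda>k. F k x) \<longlonglongrightarrow> \<bar>f x\<bar>" if x: "x \<in> space M" for x
  proof -
    obtain k0 where k0: "x \<in> A k0" using A(2) x by auto
    have "(\<lambda>k. min \<bar>f x\<bar> (ereal (real k))) \<longlonglongrightarrow> min \<bar>f x\<bar> \<infinity>"
      by (intro tendsto_min tendsto_const) (simp add: id_nat_ereal_tendsto_PInf)
    moreover have "eventually (\<lambda>k. min \<bar>f x\<bar> (ereal (real k)) = F k x) sequentially"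
      using eventually_ge_at_top[of k0]
    proof eventually_elim
      case (elim k)
      with k0 A(4) have "x \<in> A k" by (auto simp: incseq_def)
      then show ?case by (simp add: F_def)
    qed
    ultimately show ?thesis by (auto intro: Lim_transform_eventually)
  qed
  have FX: "F k \<in> fun_space M N" for k
  proof -
    have "N (F k) \<le> N (\<lambda>x. ereal (real k) * indicator (A k) x)"
      by (rule quasi_norm_mono[OF N]) (auto simp: F_def split: split_indicator)
    also have "\<dots> = ennreal \<bar>real k\<bar> * N (indicator (A k))"
      by (rule quasi_norm_scale[OF N]) measurable
    also have "\<dots> < \<infinity>"
      using quasi_norm_indicator[OF N, of "A k"] A(3)[of k] by (auto simp: ennreal_mult_less_top less_top)
    finally show ?thesis by (simp add: fun_space_def)
  qed
  have NF: "N (F k) = Nb (rearr M (F k))" for k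
    by (rule eq[OF FX, of _ "real k"]) (auto simp: F_def split: split_indicator)
  have "(\<lambda>k. N (F k)) \<longlonglongrightarrow> N (\<lambda>x. \<bar>f x\<bar>)"
    using F0 F_inc F_lim by (intro quasi_norm_tendsto[OF N] AE_I2) auto
  moreover have "N (\<lambda>x. \<bar>f x\<bar>) = N f"
    by (intro antisym quasi_norm_mono[OF N]) auto
  moreover have "(\<lambda>k. Nb (rearr M (F k))) \<longlonglongrightarrow> Nb (rearr M f)"
  proof (rule quasi_norm_tendsto[OF Nb, of "\<lambda>k. rearr M (F k)"])
    show "rearr M (F k) \<in> borel_measurable half_line" for k
      by (intro borel_measurable_half_line borel_measurable_rearr F_meas)
    show "rearr M f \<in> borel_measurable half_line"
      by (intro borel_measurable_half_line borel_measurable_rearr f)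
    have inc: "incseq (\<lambda>k. rearr M (F k) t)" for t
      using F_inc by (intro monoI rearr_mono distrib_mono AE_I2) (auto dest: incseqD)
    have "(\<lambda>k. rearr M (F k) t) \<longlonglongrightarrow> rearr M f t" for t
    proof (rule order_tendstoI)
      fix a assume a: "a < rearr M f t"
      show "eventually (\<lambda>k. a < rearr M (F k) t) sequentially"
      proof (cases "a < 0")
        case True then show ?thesis by (simp add: less_le_trans[OF True rearr_nonneg])
      next
        case False
        then have ea: "enn2ereal (e2ennreal a) = a" by (simp add: enn2ereal_e2ennreal)
        have "ennreal t < distrib M f (e2ennreal a)"
          using a less_rearr_iff[OF f, of "e2ennreal a" t] by (simp add: ea)
        also have "distrib M f (e2ennreal a) = (SUP k. distrib M (F k) (e2ennreal a))"
          using F_inc F_lim by (intro distrib_SUP) auto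
        finally obtain k where "ennreal t < distrib M (F k) (e2ennreal a)"
          by (auto simp: less_SUP_iff)
        then have "a < rearr M (F k) t"
          using less_rearr_iff[OF F_meas, of "e2ennreal a" k t] by (simp add: ea)
        then show ?thesis
          using inc[of t] unfolding eventually_sequentially incseq_def by (blast intro: less_le_trans)
      qed
    next
      fix a assume a: "rearr M f t < a"
      have "rearr M (F k) t \<le> rearr M f t" for k
        by (intro rearr_mono distrib_mono AE_I2) (auto simp: F_def split: split_indicator)
      then show "eventually (\<lambda>k. rearr M (F k) t < a) sequentially"
        using le_less_trans[OF _ a] by (intro always_eventually allI) blast
    qed
    with inc show "AE t in half_line. (\<forall>k. 0 \<le> rearr M (F k) t) \<and> incseq (\<lambda>k. rearr M (F k) t) \<and>
        (\<lambda>k. rearr M (F k) t) \<longlonglongrightarrow> rearr M f t"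
      by (intro AE_I2) simp
  qed
  ultimately show ?thesis
    unfolding NF by (metis LIMSEQ_unique)
qed

lemma representation_norm:
  fixes N :: "(real^'n) functional"
  assumes "ri_space lebesgue N" "representation_space N Nb" "f \<in> borel_measurable lebesgue"
  shows "Nb (rearr lebesgue f) = N f"
  by (rule norm_rearr[OF sigma_finite_lebesgue _ _ _ assms(3)])
     (use assms in \<open>auto simp: representation_space_def ri_space_def\<close>)

lemma rearrangement_invariantD:
  assumes "rearrangement_invariant M N" "f \<in> borel_measurable M" "g \<in> borel_measurable M"
    "AE x in M. \<bar>f x\<bar> < \<infinity>" "AE x in M. \<bar>g x\<bar> < \<infinity>"
    "\<And>t. 0 < t \<Longrightarrow> emeasure M {x \<in> space M. ereal t < \<bar>f x\<bar>} =
      emeasure M {x \<in> space M. ereal t < \<bar>g x\<bar>}"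
  shows "N f = N g"
  using assms unfolding rearrangement_invariant_def by blast

lemma ri_norm_half_line:
  assumes N: "ri_space half_line N" and f: "f \<in> borel_measurable half_line"
  shows "N (rearr half_line f) = N f"
proof (rule norm_rearr[OF sigma_finite_half_line _ _ _ f])
  show "quasi_normed_function_space half_line N" "quasi_normed_function_space half_line N"
    using N by (auto simp: ri_space_def)
  fix g c assume g: "g \<in> fun_space half_line N" and c: "\<And>x. \<bar>g x\<bar> \<le> ereal c"
  then have gm: "g \<in> borel_measurable half_line" by (simp add: fun_space_def)
  have c0: "0 \<le> ereal c" by (rule order_trans[OF _ c[of 0]]) simp
  have le: "rearr half_line g t \<le> ereal c" for t
  proof -
    have "\<not> enn2ereal (e2ennreal (ereal c)) < rearr half_line g t"
    proof -
      have "{x \<in> space half_line. ereal c < \<bar>g x\<bar>} = {}" using c by (auto simp: not_less[symmetric])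
      then show ?thesis
        using c0 by (subst less_rearr_iff[OF gm])
          (simp only: distrib_def enn2ereal_e2ennreal emeasure_empty not_less_zero not_False_eq_True)
    qed
    with c0 show ?thesis by (simp add: enn2ereal_e2ennreal)
  qed
  have *: "emeasure half_line {x \<in> space half_line. ereal t < \<bar>g x\<bar>} =
      emeasure half_line {x \<in> space half_line. ereal t < \<bar>rearr half_line g x\<bar>}" if "0 < t" for t
  proof -
    have "enn2ereal (ennreal t) = ereal t" using that by (simp add: enn2ereal_ennreal)
    then show ?thesis
      using fun_cong[OF distrib_rearr[OF gm], of "ennreal t"] by (simp only: distrib_def)
  qed
  have "AE x in half_line. \<bar>g x\<bar> < \<infinity>"
    by (rule AE_I2, rule le_less_trans[OF c]) simp
  moreover have "AE x in half_line. \<bar>rearr half_line g x\<bar> < \<infinity>"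
    unfolding abs_rearr by (rule AE_I2, rule le_less_trans[OF le]) simp
  moreover have "rearr half_line g \<in> borel_measurable half_line"
    by (intro borel_measurable_half_line borel_measurable_rearr gm)
  moreover have "rearrangement_invariant half_line N" using N by (simp add: ri_space_def)
  ultimately show "N g = N (rearr half_line g)"
    using gm * by (intro rearrangement_invariantD[where M = half_line and N = N])
qed

section \<open>Radial functions\<close>

lemma unit_ball_vol_real_pos [simp]: "0 < unit_ball_vol (real n)"
  by (rule unit_ball_vol_pos) simp

lemma emeasure_lebesgue_ball:
  fixes x :: "real^'n"
  assumes "0 \<le> r"
  shows "emeasure lebesgue (ball x r) = ennreal (unit_ball_vol (real CARD('n)) * r ^ CARD('n))"
  using emeasure_ball[OF assms, of x] by (simp add: emeasure_completion)

definition radial :: "(real \<Rightarrow> ereal) \<Rightarrow> real^'n \<Rightarrow> ereal" where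
  "radial g x = (if x = 0 then 0 else g (unit_ball_vol (real CARD('n)) * norm x ^ CARD('n)))"

lemma ennreal_ball_volume_less_iff:
  fixes x :: "'a::real_normed_vector"
  assumes "0 < v" "0 \<le> \<rho>" "0 < n"
  shows "ennreal (v * norm x ^ n) < ennreal (v * \<rho> ^ n) \<longleftrightarrow> norm x < \<rho>"
proof -
  have "ennreal (v * norm x ^ n) < ennreal (v * \<rho> ^ n) \<longleftrightarrow> norm x ^ n < \<rho> ^ n"
    using assms(1) by (subst ennreal_less_iff) auto
  also have "\<dots> \<longleftrightarrow> norm x < \<rho>"
    using assms(2,3) power_less_imp_less_base power_strict_mono norm_ge_zero by metis
  finally show ?thesis .
qed

lemma emeasure_radial_segment:
  "{x::real^'n. x \<noteq> 0 \<and> ennreal (unit_ball_vol (real CARD('n)) * norm x ^ CARD('n)) < a} \<in> sets borel"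
  "emeasure lebesgue {x::real^'n. x \<noteq> 0 \<and> ennreal (unit_ball_vol (real CARD('n)) * norm x ^ CARD('n)) < a} = a"
proof -
  let ?v = "unit_ball_vol (real CARD('n))"
  let ?S = "\<lambda>a. {x::real^'n. x \<noteq> 0 \<and> ennreal (?v * norm x ^ CARD('n)) < a}"
  show meas: "?S a \<in> sets borel" for a by measurable
  have real: "emeasure lebesgue (?S (ennreal b)) = ennreal b" if "0 \<le> b" for b
  proof -
    define \<rho> where "\<rho> = root CARD('n) (b / ?v)"
    have \<rho>: "0 \<le> \<rho>" "?v * \<rho> ^ CARD('n) = b"
      using that less_imp_neq[OF unit_ball_vol_real_pos[of "CARD('n)"]]
      by (auto simp: \<rho>_def intro!: real_root_ge_zero divide_nonneg_pos)
    have "?S (ennreal b) = ball 0 \<rho> - {0}"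
    proof -
      have "ennreal (?v * norm x ^ CARD('n)) < ennreal b \<longleftrightarrow> norm x < \<rho>" for x :: "real^'n"
        unfolding \<rho>(2)[symmetric] using \<rho>(1) by (intro ennreal_ball_volume_less_iff) auto
      then show ?thesis
        by (simp only: set_eq_iff mem_Collect_eq Diff_iff mem_ball_0 singleton_iff) blast
    qed
    also have "emeasure lebesgue (ball 0 \<rho> - {0::real^'n}) = emeasure lebesgue (ball (0::real^'n) \<rho>)"
      by (rule emeasure_Diff_null_set) auto
    finally show ?thesis by (simp only: emeasure_lebesgue_ball[OF \<rho>(1)] \<rho>(2))
  qed
  show "emeasure lebesgue (?S a) = a"
  proof (cases a)
    case (real b)
    then show ?thesis using \<open>\<And>b. 0 \<le> b \<Longrightarrow> _ b\<close> by simp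
  next
    case top
    have "ennreal (real m) \<le> emeasure lebesgue (?S a)" for m
      using emeasure_mono[of "?S (ennreal (real m))" "?S a" lebesgue] meas[of a] real[of "real m"] top
      by (auto simp: sets_completionI_sets)
    with top show ?thesis by (simp only: ennreal_eq_topI)
  qed
qed

lemma radial_nonneg: "(\<And>t. 0 \<le> g t) \<Longrightarrow> 0 \<le> radial g x"
  by (simp add: radial_def)

lemma less_radial_rearr_iff:
  fixes x :: "real^'n"
  assumes "f \<in> borel_measurable M"
  shows "enn2ereal s < radial (rearr M f) x \<longleftrightarrow>
    x \<noteq> 0 \<and> ennreal (unit_ball_vol (real CARD('n)) * norm x ^ CARD('n)) < distrib M f s"
  using less_rearr_iff[OF assms] by (simp add: radial_def not_less)

lemma borel_measurable_radial_rearr [measurable]: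
  assumes "f \<in> borel_measurable M"
  shows "(radial (rearr M f) :: real^'n \<Rightarrow> ereal) \<in> borel_measurable borel"
  unfolding radial_def using borel_measurable_rearr[OF assms] by measurable

lemma lebesgue_measurable_radial_rearr [measurable]:
  assumes "f \<in> borel_measurable M"
  shows "(radial (rearr M f) :: real^'n \<Rightarrow> ereal) \<in> borel_measurable lebesgue"
  using borel_measurable_radial_rearr[OF assms] by (intro measurable_completion) simp

lemma distrib_radial_rearr:
  assumes "f \<in> borel_measurable M"
  shows "distrib lebesgue (radial (rearr M f) :: real^'n \<Rightarrow> ereal) = distrib M f"
proof -
  have "\<bar>radial (rearr M f) x\<bar> = radial (rearr M f) x" for x :: "real^'n"
    by (simp add: radial_nonneg)
  then show ?thesis
    by (simp add: fun_eq_iff distrib_def[of lebesgue] less_radial_rearr_iff[OF assms] emeasure_radial_segment(2))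
qed

lemma rearr_radial_rearr:
  assumes "f \<in> borel_measurable M"
  shows "rearr lebesgue (radial (rearr M f) :: real^'n \<Rightarrow> ereal) = rearr M f"
  by (rule rearr_cong) (simp add: distrib_radial_rearr[OF assms])

lemma nn_integral_ball_radial_rearr:
  assumes f: "f \<in> borel_measurable M" and \<rho>: "0 \<le> \<rho>"
  shows "(\<integral>\<^sup>+x\<in>ball (0::real^'n) \<rho>. e2ennreal \<bar>radial (rearr M f) x\<bar> \<partial>lebesgue) =
    (\<integral>\<^sup>+t\<in>{0<..<unit_ball_vol (real CARD('n)) * \<rho> ^ CARD('n)}. e2ennreal (rearr M f t) \<partial>lebesgue)"
proof -
  let ?a = "unit_ball_vol (real CARD('n)) * \<rho> ^ CARD('n)" and ?f = "radial (rearr M f) :: real^'n \<Rightarrow> ereal"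
  have [measurable]: "ball (0::real^'n) \<rho> \<in> sets lebesgue" by simp
  have "(\<lambda>x. e2ennreal \<bar>?f x\<bar>) \<in> borel_measurable lebesgue"
    by (rule measurable_compose[OF lebesgue_measurable_radial_rearr[OF f]]) measurable
  then have meas: "(\<lambda>x. e2ennreal \<bar>?f x\<bar> * indicator (ball 0 \<rho>) x) \<in> borel_measurable lebesgue"
    by measurable
  have abs: "\<bar>?f x\<bar> = ?f x" for x by (simp add: radial_nonneg)
  have "(\<integral>\<^sup>+x\<in>ball (0::real^'n) \<rho>. e2ennreal \<bar>?f x\<bar> \<partial>lebesgue) =
    (\<integral>\<^sup>+s\<in>{0<..}. emeasure lebesgue {x \<in> space lebesgue. ennreal s < e2ennreal \<bar>?f x\<bar> * indicator (ball 0 \<rho>) x} \<partial>lborel)"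
    by (intro layer_cake sigma_finite_lebesgue meas)
  also have "\<dots> = (\<integral>\<^sup>+s\<in>{0<..}. min (ennreal ?a) (distrib M f (ennreal s)) \<partial>lborel)"
  proof (intro nn_integral_cong arg_cong2[where f = "(*)"] refl)
    fix s :: real
    have "norm x < \<rho> \<longleftrightarrow> ennreal (unit_ball_vol (real CARD('n)) * norm x ^ CARD('n)) < ennreal ?a" for x :: "real^'n"
      using \<rho> by (intro ennreal_ball_volume_less_iff[symmetric]) auto
    then have "{x \<in> space lebesgue. ennreal s < e2ennreal \<bar>?f x\<bar> * indicator (ball 0 \<rho>) x} =
      {x. x \<noteq> 0 \<and> ennreal (unit_ball_vol (real CARD('n)) * norm x ^ CARD('n)) < min (ennreal ?a) (distrib M f (ennreal s))}"
      using less_radial_rearr_iff[OF f, where 'n='n, of "ennreal s"] enn2ereal_less_abs_iff[of "ennreal s" "?f _"]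
      unfolding abs by (auto split: split_indicator)
    then show "emeasure lebesgue {x \<in> space lebesgue. ennreal s < e2ennreal \<bar>?f x\<bar> * indicator (ball 0 \<rho>) x} =
       min (ennreal ?a) (distrib M f (ennreal s))"
      using emeasure_radial_segment(2)[where 'n='n] by (simp only:)
  qed
  finally show ?thesis by (simp only: nn_integral_rearr[OF f])
qed

section \<open>Substitution and covering\<close>

lemma nn_integral_power_substitution:
  fixes G :: "real \<Rightarrow> ennreal"
  assumes [measurable]: "G \<in> borel_measurable borel" and v: "0 < v" and a: "0 \<le> a" and n: "0 < n"
  shows "(\<integral>\<^sup>+s\<in>{v * a ^ n<..}. G s \<partial>lborel) =
    (\<integral>\<^sup>+r\<in>{a<..}. G (v * r ^ n) * ennreal (v * real n * r ^ (n - 1)) \<partial>lborel)"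
proof -
  let ?b = "\<lambda>N::nat. a + real (Suc N)"
  have b: "mono ?b" by (simp add: mono_def)
  have gb: "v * ?b M ^ n \<le> v * ?b N ^ n" if "M \<le> N" for M N
    using that a v by (intro mult_left_mono power_mono) auto
  have eq: "(\<integral>\<^sup>+s. G s * indicator {v * a ^ n..v * ?b N ^ n} s \<partial>lborel) =
    (\<integral>\<^sup>+r. G (v * r ^ n) * ennreal (v * real n * r ^ (n - 1)) * indicator {a..?b N} r \<partial>lborel)" for N
    using a v by (intro nn_integral_substitution_aux) (auto intro!: derivative_eq_intros continuous_intros mult_nonneg_nonneg)
  have "(\<integral>\<^sup>+s\<in>{v * a ^ n<..}. G s \<partial>lborel) = (\<integral>\<^sup>+s. G s * indicator {v * a ^ n..} s \<partial>lborel)"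
    using AE_lborel_singleton[of "v * a ^ n"] by (intro nn_integral_cong_AE) (auto split: split_indicator)
  also have "\<dots> = (\<integral>\<^sup>+s. (SUP N. G s * indicator {v * a ^ n..v * ?b N ^ n} s) \<partial>lborel)"
  proof (intro nn_integral_cong)
    fix s :: real
    have "\<exists>N. s \<le> v * ?b N ^ n"
    proof -
      obtain N where N: "s / v \<le> real N" using real_arch_simple by blast
      have "s / v \<le> ?b N ^ 1" using N a by simp
      also have "\<dots> \<le> ?b N ^ n" using n a by (intro power_increasing) auto
      finally show ?thesis using v by (auto simp: field_simps)
    qed
    then obtain N where N: "s \<le> v * ?b N ^ n" by blast
    show "G s * indicator {v * a ^ n..} s = (SUP N. G s * indicator {v * a ^ n..v * ?b N ^ n} s)"
    proof (intro antisym SUP_least)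
      show "G s * indicator {v * a ^ n..} s \<le> (SUP N. G s * indicator {v * a ^ n..v * ?b N ^ n} s)"
        using N by (intro SUP_upper2[of N]) (auto split: split_indicator)
    qed (auto split: split_indicator)
  qed
  also have "\<dots> = (SUP N. \<integral>\<^sup>+s. G s * indicator {v * a ^ n..v * ?b N ^ n} s \<partial>lborel)"
    using gb by (intro nn_integral_monotone_convergence_SUP)
      (fastforce simp: incseq_def le_fun_def split: split_indicator intro: order_trans)+
  also have "\<dots> = (SUP N. \<integral>\<^sup>+r. G (v * r ^ n) * ennreal (v * real n * r ^ (n - 1)) * indicator {a..?b N} r \<partial>lborel)"
    by (simp only: eq)
  also have "\<dots> = (\<integral>\<^sup>+r. (SUP N. G (v * r ^ n) * ennreal (v * real n * r ^ (n - 1)) * indicator {a..?b N} r) \<partial>lborel)"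
    by (intro nn_integral_monotone_convergence_SUP[symmetric])
      (fastforce simp: incseq_def le_fun_def split: split_indicator)+
  also have "\<dots> = (\<integral>\<^sup>+r. G (v * r ^ n) * ennreal (v * real n * r ^ (n - 1)) * indicator {a..} r \<partial>lborel)"
  proof (intro nn_integral_cong)
    fix r :: real
    obtain N where N: "r - a \<le> real N" using real_arch_simple by blast
    show "(SUP N. G (v * r ^ n) * ennreal (v * real n * r ^ (n - 1)) * indicator {a..?b N} r) =
      G (v * r ^ n) * ennreal (v * real n * r ^ (n - 1)) * indicator {a..} r"
    proof (intro antisym SUP_least)
      show "G (v * r ^ n) * ennreal (v * real n * r ^ (n - 1)) * indicator {a..} r \<le>
        (SUP N. G (v * r ^ n) * ennreal (v * real n * r ^ (n - 1)) * indicator {a..?b N} r)"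
        using N by (intro SUP_upper2[of N]) (auto split: split_indicator)
    qed (auto split: split_indicator)
  qed
  also have "\<dots> = (\<integral>\<^sup>+r\<in>{a<..}. G (v * r ^ n) * ennreal (v * real n * r ^ (n - 1)) \<partial>lborel)"
    using AE_lborel_singleton[of a] by (intro nn_integral_cong_AE) (auto split: split_indicator)
  finally show ?thesis .
qed

lemma weak_type_covering:
  fixes g :: "real^'n \<Rightarrow> ennreal"
  assumes g [measurable]: "g \<in> borel_measurable lebesgue" and L: "0 \<le> L"
  obtains S where "S \<in> sets lebesgue"
    "ennreal L * emeasure lebesgue S \<le> ennreal (5 ^ CARD('n) * unit_ball_vol (real CARD('n))) * (\<integral>\<^sup>+x. g x \<partial>lebesgue)"
    "\<And>x r. x \<notin> S \<Longrightarrow> 0 < r \<Longrightarrow> r \<le> R \<Longrightarrow> (\<integral>\<^sup>+y\<in>ball x r. g y \<partial>lebesgue) \<le> ennreal (L * r ^ CARD('n))"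
proof -
  let ?v = "unit_ball_vol (real CARD('n))" and ?n = "CARD('n)"
  define K where "K = {(x, r). 0 < r \<and> r \<le> R \<and> ennreal (L * r ^ ?n) < (\<integral>\<^sup>+y\<in>ball x r. g y \<partial>lebesgue)}"
  have K: "0 < snd i \<and> snd i \<le> R" if "i \<in> K" for i
    using that by (auto simp: K_def)
  obtain C where C: "countable C" "C \<subseteq> K"
    "pairwise (\<lambda>i j. disjnt (ball (fst i) (snd i)) (ball (fst j) (snd j))) C"
    and cover: "(\<Union>i\<in>K. ball (fst i) (snd i)) \<subseteq> (\<Union>i\<in>C. ball (fst i) (5 * snd i))"
  proof (rule Vitali_covering_lemma_balls[where K = K and a = fst and r = snd and B = R, OF order_refl K])
    fix C assume "countable C" "C \<subseteq> K" "pairwise (\<lambda>i j. disjnt (ball (fst i) (snd i)) (ball (fst j) (snd j))) C"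
      "(\<Union>i\<in>K. ball (fst i) (snd i)) \<subseteq> (\<Union>i\<in>C. ball (fst i) (5 * snd i))"
    then show thesis by (rule that)
  qed
  define J where "J = to_nat_on C ` C"
  define B where "B l i = (if i \<in> J then ball (fst (from_nat_into C i)) (l * snd (from_nat_into C i)) else {})"
    for l i
  have inC: "from_nat_into C i \<in> C" if "i \<in> J" for i
    using that C(1) by (auto simp: J_def)
  have B_sets: "B l i \<in> sets lebesgue" for l i by (simp add: B_def)
  have disj: "disjoint_family (B 1)"
    unfolding disjoint_family_on_def
  proof (intro ballI impI)
    fix i j :: nat assume "i \<noteq> j"
    show "B 1 i \<inter> B 1 j = {}"
    proof (cases "i \<in> J \<and> j \<in> J")
      case True
      with \<open>i \<noteq> j\<close> C(1) have "from_nat_into C i \<noteq> from_nat_into C j"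
        by (auto simp: J_def)
      with True C(3) inC show ?thesis
        by (auto simp: B_def pairwise_def disjnt_def)
    qed (auto simp: B_def)
  qed
  define S where "S = (\<Union>i. B 5 i)"
  have S_eq: "S = (\<Union>i\<in>C. ball (fst i) (5 * snd i))"
    using C(1) by (auto simp: S_def B_def J_def split: if_split_asm)
  have ball_le: "ennreal L * emeasure lebesgue (B 5 i) \<le> ennreal (5 ^ ?n * ?v) * emeasure (density lebesgue g) (B 1 i)" for i
  proof (cases "i \<in> J")
    case True
    obtain x r where xr: "from_nat_into C i = (x, r)" by force
    with inC[OF True] C(2) have r: "0 < r" "ennreal (L * r ^ ?n) < (\<integral>\<^sup>+y\<in>ball x r. g y \<partial>lebesgue)"
      by (auto simp: K_def)
    have "emeasure lebesgue (B 5 i) = ennreal (?v * (5 * r) ^ ?n)"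
      using True xr r emeasure_lebesgue_ball[of "5 * r" x] by (simp only: B_def if_True fst_conv snd_conv)
    then have "ennreal L * emeasure lebesgue (B 5 i) = ennreal (5 ^ ?n * ?v) * ennreal (L * r ^ ?n)"
      using r L by (simp add: ennreal_mult[symmetric] power_mult_distrib mult_ac)
    also have "\<dots> \<le> ennreal (5 ^ ?n * ?v) * (\<integral>\<^sup>+y\<in>ball x r. g y \<partial>lebesgue)"
      using r by (intro mult_left_mono) auto
    also have "(\<integral>\<^sup>+y\<in>ball x r. g y \<partial>lebesgue) = emeasure (density lebesgue g) (B 1 i)"
      using True xr by (simp add: B_def emeasure_density)
    finally show ?thesis .
  qed (simp add: B_def)
  show thesis
  proof (rule that[of S])
    show "S \<in> sets lebesgue" unfolding S_def using B_sets by blast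
    have "ennreal L * emeasure lebesgue S \<le> ennreal L * (\<Sum>i. emeasure lebesgue (B 5 i))"
      unfolding S_def using B_sets by (intro mult_left_mono emeasure_subadditive_countably) auto
    also have "\<dots> = (\<Sum>i. ennreal L * emeasure lebesgue (B 5 i))"
      by simp
    also have "\<dots> \<le> (\<Sum>i. ennreal (5 ^ ?n * ?v) * emeasure (density lebesgue g) (B 1 i))"
      by (intro suminf_le ball_le) auto
    also have "\<dots> = ennreal (5 ^ ?n * ?v) * (\<Sum>i. emeasure (density lebesgue g) (B 1 i))"
      by simp
    also have "(\<Sum>i. emeasure (density lebesgue g) (B 1 i)) = emeasure (density lebesgue g) (\<Union>i. B 1 i)"
      using B_sets disj by (intro suminf_emeasure) auto
    also have "\<dots> \<le> emeasure (density lebesgue g) (space lebesgue)"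
      using emeasure_space[of "density lebesgue g"] by simp
    also have "\<dots> = (\<integral>\<^sup>+x. g x \<partial>lebesgue)"
      by (subst emeasure_density) (auto intro!: nn_integral_cong)
    finally show "ennreal L * emeasure lebesgue S \<le> ennreal (5 ^ ?n * ?v) * (\<integral>\<^sup>+x. g x \<partial>lebesgue)"
      by (simp add: mult_left_mono)
    fix x r assume *: "x \<notin> S" "0 < r" "r \<le> R"
    show "(\<integral>\<^sup>+y\<in>ball x r. g y \<partial>lebesgue) \<le> ennreal (L * r ^ ?n)"
    proof (rule ccontr)
      assume "\<not> ?thesis"
      with * have "(x, r) \<in> K" by (auto simp: K_def not_le)
      then have "x \<in> (\<Union>i\<in>K. ball (fst i) (snd i))" using * by (intro UN_I[of "(x, r)"]) auto
      with cover * show False unfolding S_eq by blast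
    qed
  qed
qed

section \<open>Potentials and Hardy operators\<close>

definition hardy_tail :: "real \<Rightarrow> (real \<Rightarrow> real) \<Rightarrow> (real \<Rightarrow> real) \<Rightarrow> real \<Rightarrow> ennreal" where
  "hardy_tail \<beta> \<psi> \<Phi> t = (\<integral>\<^sup>+s\<in>{t<..}. ennreal (s powr (\<beta> - 1) * \<psi> (s powr (\<beta> - 1) * \<Phi> s)) \<partial>lebesgue)"

definition primitive :: "(real \<Rightarrow> ereal) \<Rightarrow> real \<Rightarrow> real" where
  "primitive \<phi> s = enn2real (\<integral>\<^sup>+y\<in>{0<..<s}. e2ennreal (\<phi> y) \<partial>lebesgue)"

lemma hardy_operator_hardy_tail: "hardy_operator \<beta> \<psi> \<phi> = hardy_tail \<beta> \<psi> (primitive \<phi>)"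
  by (simp add: hardy_operator_def hardy_tail_def primitive_def fun_eq_iff)

lemma primitive_nonneg [simp]: "0 \<le> primitive \<phi> s"
  by (simp add: primitive_def)

lemma primitive_scale:
  assumes "\<phi> \<in> borel_measurable half_line" "0 < c"
  shows "primitive (\<lambda>y. ereal c * \<phi> y) s = c * primitive \<phi> s"
proof -
  have "(\<lambda>y. indicator {..<s} y :: ennreal) \<in> borel_measurable half_line"
    by (intro borel_measurable_half_line) simp
  then have meas: "(\<lambda>y. e2ennreal (\<phi> y) * indicator {..<s} y) \<in> borel_measurable half_line"
    by (intro borel_measurable_times_ennreal measurable_compose[OF assms(1) measurable_e2ennreal])
  have eq: "(\<integral>\<^sup>+y\<in>{0<..<s}. e2ennreal (g y) \<partial>lebesgue) = (\<integral>\<^sup>+y. e2ennreal (g y) * indicator {..<s} y \<partial>half_line)" for g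
    by (subst nn_integral_restrict_space) (auto intro!: nn_integral_cong split: split_indicator)
  have "e2ennreal (ereal c * y) = ennreal c * e2ennreal y" for y
  proof (cases "0 \<le> y")
    case True
    then have "ereal c * y = enn2ereal (ennreal c * e2ennreal y)"
      using assms(2) by (simp add: times_ennreal.rep_eq enn2ereal_e2ennreal)
    then show ?thesis by simp
  next
    case False
    then have "ereal c * y \<le> 0" using assms(2) by (cases y) (auto simp: mult_le_0_iff)
    with False show ?thesis by (simp add: e2ennreal_neg)
  qed
  then have "(\<integral>\<^sup>+y\<in>{0<..<s}. e2ennreal (ereal c * \<phi> y) \<partial>lebesgue) =
    ennreal c * (\<integral>\<^sup>+y\<in>{0<..<s}. e2ennreal (\<phi> y) \<partial>lebesgue)"
    unfolding eq using meas by (simp add: mult.assoc nn_integral_cmult)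
  then show ?thesis using assms(2) by (simp add: primitive_def enn2real_mult)
qed

lemma primitive_mono:
  assumes "\<And>s. 0 < s \<Longrightarrow> (\<integral>\<^sup>+y\<in>{0<..<s}. e2ennreal (\<phi> y) \<partial>lebesgue) < \<infinity>"
  shows "mono (primitive \<phi>)"
proof (rule monoI)
  fix s t :: real assume "s \<le> t"
  show "primitive \<phi> s \<le> primitive \<phi> t"
  proof (cases "0 < t")
    case True
    show ?thesis unfolding primitive_def
    proof (rule enn2real_mono)
      show "(\<integral>\<^sup>+y\<in>{0<..<s}. e2ennreal (\<phi> y) \<partial>lebesgue) \<le> (\<integral>\<^sup>+y\<in>{0<..<t}. e2ennreal (\<phi> y) \<partial>lebesgue)"
        using \<open>s \<le> t\<close> by (intro nn_integral_mono) (auto split: split_indicator)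
      show "(\<integral>\<^sup>+y\<in>{0<..<t}. e2ennreal (\<phi> y) \<partial>lebesgue) < top"
        using assms[OF True] by simp
    qed
  next
    case False
    with \<open>s \<le> t\<close> show ?thesis by (simp add: primitive_def)
  qed
qed

lemma borel_measurable_mono_compose:
  fixes \<psi> :: "real \<Rightarrow> real"
  assumes "mono_on {0..} \<psi>" "h \<in> borel_measurable M" "\<And>x. 0 \<le> h x"
  shows "(\<lambda>x. \<psi> (h x)) \<in> borel_measurable M"
proof -
  have "mono (\<lambda>y. \<psi> (max 0 y))"
    using assms(1) by (intro monoI) (auto simp: mono_on_def)
  then have "(\<lambda>y. \<psi> (max 0 y)) \<in> borel_measurable borel" by (rule borel_measurable_mono)
  then have "(\<lambda>x. \<psi> (max 0 (h x))) \<in> borel_measurable M"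
    using assms(2) by (rule measurable_compose[rotated])
  then show ?thesis using assms(3) by (simp add: max_absorb2)
qed

lemma hardy_tail_mono:
  assumes "mono_on {0..} \<psi>" "0 \<le> t" "\<And>s. t < s \<Longrightarrow> 0 \<le> \<Phi>1 s \<and> \<Phi>1 s \<le> \<Phi>2 s"
  shows "hardy_tail \<beta> \<psi> \<Phi>1 t \<le> hardy_tail \<beta> \<psi> \<Phi>2 t"
  unfolding hardy_tail_def
proof (intro nn_integral_mono)
  fix s :: real
  have "\<psi> (s powr (\<beta> - 1) * \<Phi>1 s) \<le> \<psi> (s powr (\<beta> - 1) * \<Phi>2 s)" if "t < s"
    using assms(3)[OF that] by (intro mono_onD[OF assms(1)] mult_left_mono) auto
  then show "ennreal (s powr (\<beta> - 1) * \<psi> (s powr (\<beta> - 1) * \<Phi>1 s)) * indicator {t<..} s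
    \<le> ennreal (s powr (\<beta> - 1) * \<psi> (s powr (\<beta> - 1) * \<Phi>2 s)) * indicator {t<..} s"
    by (auto split: split_indicator intro!: ennreal_leI mult_left_mono)
qed

lemma hardy_tail_antimono: "t \<le> t' \<Longrightarrow> hardy_tail \<beta> \<psi> \<Phi> t' \<le> hardy_tail \<beta> \<psi> \<Phi> t"
  unfolding hardy_tail_def by (intro nn_integral_mono) (auto split: split_indicator)

lemma hardy_tail_substitution:
  assumes psi: "\<And>x. 0 \<le> x \<Longrightarrow> 0 \<le> \<psi> x" "mono_on {0..} \<psi>"
    and \<Phi>: "\<Phi> \<in> borel_measurable borel" "\<And>s. 0 \<le> \<Phi> s"
    and v: "0 < v" and a: "0 \<le> a" and n: "0 < n"
  shows "(\<integral>\<^sup>+r\<in>{a<..}. ennreal (r powr (\<alpha> - 1) * \<psi> (r powr (\<alpha> - real n) * \<Phi> (v * r ^ n))) \<partial>lebesgue) =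
    ennreal (v powr (- (\<alpha> / n)) / n) * hardy_tail (\<alpha> / n) \<psi> (\<lambda>s. v powr (1 - \<alpha> / n) * \<Phi> s) (v * a ^ n)"
proof -
  define \<beta> where "\<beta> = \<alpha> / n"
  define G where "G s = ennreal (s powr (\<beta> - 1) * \<psi> (s powr (\<beta> - 1) * (v powr (1 - \<beta>) * \<Phi> s)))" for s
  note [measurable] = \<Phi>(1)
  have [measurable]: "G \<in> borel_measurable borel"
    unfolding G_def using \<Phi>(2)
    by (intro measurable_compose[OF _ measurable_ennreal] borel_measurable_times borel_measurable_mono_compose[OF psi(2)])
      (measurable, auto)
  have "ennreal (v powr (- \<beta>) / n) * (G (v * r ^ n) * ennreal (v * n * r ^ (n - 1))) =
    ennreal (r powr (\<alpha> - 1) * \<psi> (r powr (\<alpha> - real n) * \<Phi> (v * r ^ n)))" if "a < r" for r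
  proof -
    have r: "0 < r" using a that by simp
    have vr: "(v * r ^ n) powr (\<beta> - 1) = v powr (\<beta> - 1) * r powr (\<alpha> - n)"
      using v r n by (simp add: powr_mult powr_realpow[symmetric] powr_powr \<beta>_def algebra_simps)
    have 1: "(v * r ^ n) powr (\<beta> - 1) * (v powr (1 - \<beta>) * \<Phi> (v * r ^ n)) = r powr (\<alpha> - n) * \<Phi> (v * r ^ n)"
      unfolding vr using v by (simp add: powr_diff)
    have "r powr (\<alpha> - n) * r ^ (n - 1) = r powr (\<alpha> - 1)"
      using r n by (simp add: powr_realpow[symmetric] powr_add[symmetric] of_nat_diff)
    moreover have "v powr (- \<beta>) * v powr (\<beta> - 1) * v = 1"
      using v by (simp add: powr_diff powr_minus)
    moreover have "v powr (- \<beta>) / n * ((v * r ^ n) powr (\<beta> - 1) * p * (v * n * r ^ (n - 1))) =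
        (v powr (- \<beta>) * v powr (\<beta> - 1) * v) * (r powr (\<alpha> - n) * r ^ (n - 1)) * p" for p
      unfolding vr using n by simp
    ultimately have 2: "v powr (- \<beta>) / n * ((v * r ^ n) powr (\<beta> - 1) * p * (v * n * r ^ (n - 1))) =
        r powr (\<alpha> - 1) * p" for p
      by simp
    show ?thesis
      unfolding G_def 1 using v r psi(1) \<Phi>(2)
      by (subst ennreal_mult[symmetric], simp, simp, subst ennreal_mult[symmetric], simp, simp, subst 2, simp)
  qed
  then have "(\<integral>\<^sup>+r\<in>{a<..}. ennreal (r powr (\<alpha> - 1) * \<psi> (r powr (\<alpha> - real n) * \<Phi> (v * r ^ n))) \<partial>lebesgue) =
     (\<integral>\<^sup>+r. ennreal (v powr (- \<beta>) / n) * (G (v * r ^ n) * ennreal (v * n * r ^ (n - 1)) * indicator {a<..} r) \<partial>lborel)"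
    unfolding nn_integral_completion by (intro nn_integral_cong) (auto split: split_indicator)
  also have "\<dots> = ennreal (v powr (- \<beta>) / n) * (\<integral>\<^sup>+r\<in>{a<..}. G (v * r ^ n) * ennreal (v * n * r ^ (n - 1)) \<partial>lborel)"
    by (intro nn_integral_cmult) measurable
  also have "(\<integral>\<^sup>+r\<in>{a<..}. G (v * r ^ n) * ennreal (v * n * r ^ (n - 1)) \<partial>lborel) =
    (\<integral>\<^sup>+s\<in>{v * a ^ n<..}. G s \<partial>lborel)"
    using v a n by (intro nn_integral_power_substitution[symmetric]) auto
  also have "\<dots> = hardy_tail \<beta> \<psi> (\<lambda>s. v powr (1 - \<beta>) * \<Phi> s) (v * a ^ n)"
    unfolding hardy_tail_def G_def nn_integral_completion ..
  finally show ?thesis by (simp add: \<beta>_def)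
qed

lemma borel_measurable_wolff_potential:
  fixes f :: "real^'n \<Rightarrow> ereal"
  assumes psi: "mono_on {0..} \<psi>" and f: "f \<in> borel_measurable lebesgue"
  shows "wolff_potential \<alpha> \<psi> f \<in> borel_measurable lebesgue"
proof -
  have "(\<lambda>x. e2ennreal \<bar>f x\<bar>) \<in> borel_measurable lebesgue"
    by (rule measurable_compose[OF f]) measurable
  then obtain g where [measurable]: "g \<in> borel_measurable lborel" and g: "AE x in lborel. e2ennreal \<bar>f x\<bar> = g x"
    using completion_ex_borel_measurable by blast
  have eq: "(\<integral>\<^sup>+y\<in>ball x r. e2ennreal \<bar>f y\<bar> \<partial>lebesgue) = (\<integral>\<^sup>+y. g y * indicator {y. dist x y < r} y \<partial>lborel)" for x r
    unfolding nn_integral_completion using g by (intro nn_integral_cong_AE) (auto simp: ball_def elim!: eventually_mono)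
  define J where "J z = (\<integral>\<^sup>+y. g y * indicator {y. dist (fst z) y < snd z} y \<partial>lborel)" for z :: "(real^'n) \<times> real"
  have [measurable]: "J \<in> borel_measurable (lborel \<Otimes>\<^sub>M lborel)"
    unfolding J_def
    by (intro lborel.borel_measurable_nn_integral) (unfold case_prod_beta indicator_def, measurable)
  define P where "P z = \<psi> (snd z powr (\<alpha> - real CARD('n)) * enn2real (J z))" for z :: "(real^'n) \<times> real"
  have "(\<lambda>z. snd z powr (\<alpha> - real CARD('n)) * enn2real (J z)) \<in> borel_measurable (lborel \<Otimes>\<^sub>M lborel)"
    by measurable
  then have [measurable]: "P \<in> borel_measurable (lborel \<Otimes>\<^sub>M lborel)"
    unfolding P_def by (rule borel_measurable_mono_compose[OF psi]) simp
  have "(\<lambda>(x, r). ennreal (r powr (\<alpha> - 1) * P (x, r)) * indicator {0<..} r) \<in> borel_measurable (lborel \<Otimes>\<^sub>M lborel)"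
    by measurable
  then have "(\<lambda>x. \<integral>\<^sup>+r. ennreal (r powr (\<alpha> - 1) * P (x, r)) * indicator {0<..} r \<partial>lborel) \<in> borel_measurable (lborel :: (real^'n) measure)"
    by (rule lborel.borel_measurable_nn_integral)
  moreover have "wolff_potential \<alpha> \<psi> f =
      (\<lambda>x. \<integral>\<^sup>+r. ennreal (r powr (\<alpha> - 1) * P (x, r)) * indicator {0<..} r \<partial>lborel)"
    unfolding wolff_potential_def P_def J_def fun_eq_iff fst_conv snd_conv eq[symmetric] by (simp add: nn_integral_completion)
  ultimately show ?thesis by (auto intro: measurable_completion)
qed

lemma wolff_radial_lower_bound:
  fixes x :: "real^'n"
  assumes psi: "\<And>x. 0 \<le> x \<Longrightarrow> 0 \<le> \<psi> x" "mono_on {0..} \<psi>"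
    and \<phi>: "\<phi> \<in> borel_measurable M"
    and fin: "\<And>s. 0 < s \<Longrightarrow> (\<integral>\<^sup>+y\<in>{0<..<s}. e2ennreal (rearr M \<phi> y) \<partial>lebesgue) < \<infinity>"
    and v: "v = unit_ball_vol (real CARD('n))" and w: "w = v / 2 ^ CARD('n)"
    and \<beta>: "\<beta> = \<alpha> / real CARD('n)"
  shows "ennreal (w powr (- \<beta>) / real CARD('n)) *
      hardy_tail \<beta> \<psi> (\<lambda>s. w powr (1 - \<beta>) * primitive (rearr M \<phi>) s) (v * norm x ^ CARD('n))
    \<le> wolff_potential \<alpha> \<psi> (radial (rearr M \<phi>)) x"
proof -
  let ?n = "CARD('n)" and ?f = "radial (rearr M \<phi>) :: real^'n \<Rightarrow> ereal" and ?\<Phi> = "primitive (rearr M \<phi>)"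
  have v0: "0 < v" by (simp add: v)
  then have w0: "0 < w" by (simp add: w)
  have f: "?f \<in> borel_measurable lebesgue" by (rule lebesgue_measurable_radial_rearr[OF \<phi>])
  have le: "?\<Phi> (w * r ^ ?n) \<le> enn2real (\<integral>\<^sup>+y\<in>ball x r. e2ennreal \<bar>?f y\<bar> \<partial>lebesgue)" if r: "2 * norm x < r" for r
  proof -
    have r0: "0 < r" using r norm_ge_zero[of x] by linarith
    have "(\<integral>\<^sup>+y\<in>{0<..<w * r ^ ?n}. e2ennreal (rearr M \<phi> y) \<partial>lebesgue) =
        (\<integral>\<^sup>+y\<in>ball 0 (r / 2). e2ennreal \<bar>?f y\<bar> \<partial>lebesgue)"
      using r0 by (subst nn_integral_ball_radial_rearr[OF \<phi>]) (auto simp: v w power_divide)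
    also have "\<dots> \<le> (\<integral>\<^sup>+y\<in>ball x r. e2ennreal \<bar>?f y\<bar> \<partial>lebesgue)"
    proof (intro nn_integral_mono mult_left_mono)
      have "y \<in> ball x r" if "y \<in> ball 0 (r / 2)" for y
        using that r norm_triangle_ineq4[of x y] by (simp add: dist_norm)
      then show "indicator (ball 0 (r / 2)) y \<le> (indicator (ball x r) y :: ennreal)" for y
        by (auto split: split_indicator)
    qed simp
    finally have *: "(\<integral>\<^sup>+y\<in>{0<..<w * r ^ ?n}. e2ennreal (rearr M \<phi> y) \<partial>lebesgue) \<le>
        (\<integral>\<^sup>+y\<in>ball x r. e2ennreal \<bar>?f y\<bar> \<partial>lebesgue)" .
    have "(\<integral>\<^sup>+y\<in>ball x r. e2ennreal \<bar>?f y\<bar> \<partial>lebesgue) \<le>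
        (\<integral>\<^sup>+y\<in>{0<..<v * r ^ ?n}. e2ennreal (rearr lebesgue ?f y) \<partial>lebesgue)"
      using f emeasure_lebesgue_ball[of r x] r0 by (intro nn_integral_le_rearr sigma_finite_lebesgue) (auto simp only: v less_imp_le order_refl lmeasurable_ball fmeasurableD)
    also have "\<dots> < top"
      using fin[of "v * r ^ ?n"] v0 r0 by (simp add: rearr_radial_rearr[OF \<phi>])
    finally show ?thesis unfolding primitive_def using * by (intro enn2real_mono)
  qed
  have "ennreal (w powr (- \<beta>) / real ?n) *
      hardy_tail \<beta> \<psi> (\<lambda>s. w powr (1 - \<beta>) * ?\<Phi> s) (v * norm x ^ ?n) =
    (\<integral>\<^sup>+r\<in>{2 * norm x<..}. ennreal (r powr (\<alpha> - 1) * \<psi> (r powr (\<alpha> - real ?n) * ?\<Phi> (w * r ^ ?n))) \<partial>lebesgue)"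
    using hardy_tail_substitution[where \<psi> = \<psi> and \<Phi> = ?\<Phi> and v = w and a = "2 * norm x" and n = ?n and \<alpha> = \<alpha>,
        OF psi borel_measurable_mono[OF primitive_mono[OF fin]]] w0
    by (simp add: \<beta> w power_mult_distrib)
  also have "\<dots> \<le> wolff_potential \<alpha> \<psi> ?f x"
    unfolding wolff_potential_def
  proof (intro nn_integral_mono)
    fix r :: real
    have "\<psi> (r powr (\<alpha> - real ?n) * ?\<Phi> (w * r ^ ?n)) \<le>
      \<psi> (r powr (\<alpha> - real ?n) * enn2real (\<integral>\<^sup>+y\<in>ball x r. e2ennreal \<bar>?f y\<bar> \<partial>lebesgue))" if "2 * norm x < r"
      using le[OF that] by (intro mono_onD[OF psi(2)] mult_left_mono) auto
    moreover have "0 < r" if "2 * norm x < r" using that norm_ge_zero[of x] by linarith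
    ultimately show "ennreal (r powr (\<alpha> - 1) * \<psi> (r powr (\<alpha> - real ?n) * ?\<Phi> (w * r ^ ?n))) * indicator {2 * norm x<..} r \<le>
      ennreal (r powr (\<alpha> - 1) * \<psi> (r powr (\<alpha> - real ?n) * enn2real (\<integral>\<^sup>+y\<in>ball x r. e2ennreal \<bar>?f y\<bar> \<partial>lebesgue))) *
        indicator {0<..} r"
      by (auto split: split_indicator intro!: ennreal_leI mult_left_mono)
  qed
  finally show ?thesis .
qed

lemma nn_integral_powr_le:
  assumes "0 < \<alpha>" "0 \<le> R"
  shows "(\<integral>\<^sup>+r\<in>{0<..R}. ennreal (r powr (\<alpha> - 1)) \<partial>lebesgue) \<le> ennreal (R powr \<alpha> / \<alpha>)"
proof -
  have "((\<lambda>r. r powr (\<alpha> - 1)) has_integral (R powr \<alpha> / \<alpha>)) {0..R}"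
    using has_integral_powr_from_0[of "\<alpha> - 1" R] assms by simp
  then have "(\<integral>\<^sup>+r. ennreal (r powr (\<alpha> - 1)) * indicator {0..R} r \<partial>lborel) = ennreal (R powr \<alpha> / \<alpha>)"
    by (intro nn_integral_has_integral_lebesgue') auto
  moreover have "(\<integral>\<^sup>+r\<in>{0<..R}. ennreal (r powr (\<alpha> - 1)) \<partial>lebesgue) \<le>
      (\<integral>\<^sup>+r. ennreal (r powr (\<alpha> - 1)) * indicator {0..R} r \<partial>lborel)"
    unfolding nn_integral_completion by (intro nn_integral_mono) (auto split: split_indicator)
  ultimately show ?thesis by simp
qed

lemma hardy_tail_lower_bound:
  assumes psi: "\<And>x. 0 \<le> x \<Longrightarrow> 0 \<le> \<psi> x" "mono_on {0..} \<psi>"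
    and \<Phi>: "mono \<Phi>" "\<And>s. 0 \<le> \<Phi> s" and t: "0 < t" and \<beta>: "\<beta> < 1" and c: "0 \<le> c"
  shows "ennreal (2 powr (\<beta> - 1) * t powr \<beta> * \<psi> (t powr (\<beta> - 1) * (c * \<Phi> t))) \<le>
    hardy_tail \<beta> \<psi> (\<lambda>s. 2 powr (1 - \<beta>) * c * \<Phi> s) t"
proof -
  let ?p = "\<psi> (t powr (\<beta> - 1) * (c * \<Phi> t))"
  have "ennreal (2 powr (\<beta> - 1) * t powr \<beta> * ?p) = ennreal ((2 * t) powr (\<beta> - 1) * ?p) * emeasure lebesgue {t<..<2 * t}"
  proof -
    have "2 powr (\<beta> - 1) * t powr \<beta> * ?p = (2 * t) powr (\<beta> - 1) * ?p * t"
      using t by (simp add: powr_mult powr_diff)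
    then show ?thesis
      using t psi(1) c \<Phi> by (simp add: ennreal_mult[symmetric])
  qed
  also have "\<dots> = (\<integral>\<^sup>+s\<in>{t<..<2 * t}. ennreal ((2 * t) powr (\<beta> - 1) * ?p) \<partial>lebesgue)"
    by (simp add: nn_integral_cmult_indicator)
  also have "\<dots> \<le> hardy_tail \<beta> \<psi> (\<lambda>s. 2 powr (1 - \<beta>) * c * \<Phi> s) t"
    unfolding hardy_tail_def
  proof (intro nn_integral_mono)
    fix s :: real
    show "ennreal ((2 * t) powr (\<beta> - 1) * ?p) * indicator {t<..<2 * t} s \<le>
      ennreal (s powr (\<beta> - 1) * \<psi> (s powr (\<beta> - 1) * (2 powr (1 - \<beta>) * c * \<Phi> s))) * indicator {t<..} s"
    proof (cases "t < s \<and> s < 2 * t")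
      case True
      then have s: "(2 * t) powr (\<beta> - 1) \<le> s powr (\<beta> - 1)"
        using t \<beta> by (intro powr_mono2') auto
      have "t powr (\<beta> - 1) * (c * \<Phi> t) = (2 * t) powr (\<beta> - 1) * (2 powr (1 - \<beta>) * c * \<Phi> t)"
        using t by (simp add: powr_mult powr_diff)
      also have "\<dots> \<le> s powr (\<beta> - 1) * (2 powr (1 - \<beta>) * c * \<Phi> s)"
        using s True \<Phi>(2) c monoD[OF \<Phi>(1), of t s] by (intro mult_mono) auto
      finally have "?p \<le> \<psi> (s powr (\<beta> - 1) * (2 powr (1 - \<beta>) * c * \<Phi> s))"
        using \<Phi>(2) c by (intro mono_onD[OF psi(2)]) auto
      with s True psi(1) \<Phi>(2) c show ?thesis
        by (auto intro!: ennreal_leI mult_mono)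
    qed (auto split: split_indicator)
  qed
  finally show ?thesis .
qed

lemma ball_integral_bound_off_small_set:
  fixes f :: "real^'n \<Rightarrow> ereal"
  assumes f: "f \<in> borel_measurable lebesgue"
    and fin: "\<And>s. 0 < s \<Longrightarrow> (\<integral>\<^sup>+y\<in>{0<..<s}. e2ennreal (rearr lebesgue f y) \<partial>lebesgue) < \<infinity>"
    and t: "0 < t" and v: "v = unit_ball_vol (real CARD('n))"
  obtains S where "S \<in> sets lebesgue" "emeasure lebesgue S \<le> ennreal t"
    "\<And>x r. x \<notin> S \<Longrightarrow> 0 < r \<Longrightarrow> r \<le> R \<Longrightarrow> (\<integral>\<^sup>+y\<in>ball x r. e2ennreal \<bar>f y\<bar> \<partial>lebesgue) \<le>
        ennreal (v * (1 + 5 ^ CARD('n)) * (primitive (rearr lebesgue f) t / t) * r ^ CARD('n))"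
proof -
  let ?n = "CARD('n)" and ?\<Phi> = "primitive (rearr lebesgue f)"
  have v0: "0 < v" by (simp add: v)
  have I: "(\<integral>\<^sup>+y\<in>{0<..<t}. e2ennreal (rearr lebesgue f y) \<partial>lebesgue) = ennreal (?\<Phi> t)"
    using fin[OF t] by (simp add: primitive_def)
  define \<tau> where "\<tau> = e2ennreal (rearr lebesgue f t)"
  define E where "E = {x \<in> space lebesgue. enn2ereal \<tau> < \<bar>f x\<bar>}"
  have \<tau>: "enn2ereal \<tau> = rearr lebesgue f t" by (simp add: \<tau>_def enn2ereal_e2ennreal)
  have [measurable]: "E \<in> sets lebesgue" unfolding E_def by (rule sets_level[OF f])
  have Et: "emeasure lebesgue E \<le> ennreal t"
    using less_rearr_iff[OF f, of \<tau> t] unfolding \<tau> by (simp add: distrib_def E_def not_less)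
  define g where "g x = e2ennreal \<bar>f x\<bar> * indicator E x" for x
  have g [measurable]: "g \<in> borel_measurable lebesgue"
    unfolding g_def using f by measurable
  have gI: "(\<integral>\<^sup>+x. g x \<partial>lebesgue) \<le> ennreal (?\<Phi> t)"
    unfolding I[symmetric] g_def by (intro nn_integral_le_rearr sigma_finite_lebesgue f Et) measurable
  have "\<tau> * ennreal t = (\<integral>\<^sup>+y\<in>{0<..<t}. \<tau> \<partial>lebesgue)"
    using t by (simp add: nn_integral_cmult_indicator)
  also have "\<dots> \<le> (\<integral>\<^sup>+y\<in>{0<..<t}. e2ennreal (rearr lebesgue f y) \<partial>lebesgue)"
    by (intro nn_integral_mono) (auto split: split_indicator simp: \<tau>_def intro!: e2ennreal_mono rearr_antimono)
  also have "\<dots> = ennreal (?\<Phi> t / t) * ennreal t"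
    using t by (simp add: I ennreal_mult[symmetric])
  finally have \<tau>_le: "\<tau> \<le> ennreal (?\<Phi> t / t)"
    using t by (simp add: ennreal_mult_le_mult_iff mult.commute[of _ "ennreal t"])
  have f_le: "e2ennreal \<bar>f y\<bar> \<le> \<tau> + g y" for y
  proof (cases "y \<in> E")
    case False
    then have "\<bar>f y\<bar> \<le> enn2ereal \<tau>" by (simp add: E_def)
    then have "e2ennreal \<bar>f y\<bar> \<le> e2ennreal (enn2ereal \<tau>)" by (rule e2ennreal_mono)
    then show ?thesis by (simp add: add_increasing2)
  qed (simp add: g_def)
  define L where "L = 5 ^ ?n * v * (?\<Phi> t / t)"
  have L0: "0 \<le> L" using v0 t by (simp add: L_def)
  obtain S where S: "S \<in> sets lebesgue" "emeasure lebesgue S \<le> ennreal t"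
    "\<And>x r. x \<notin> S \<Longrightarrow> 0 < r \<Longrightarrow> r \<le> R \<Longrightarrow> (\<integral>\<^sup>+y\<in>ball x r. g y \<partial>lebesgue) \<le> ennreal (L * r ^ ?n)"
  proof (cases "?\<Phi> t = 0")
    case True
    have "(\<integral>\<^sup>+y\<in>ball x r. g y \<partial>lebesgue) \<le> ennreal (L * r ^ ?n)" for x r
    proof -
      have "(\<integral>\<^sup>+y\<in>ball x r. g y \<partial>lebesgue) \<le> (\<integral>\<^sup>+x. g x \<partial>lebesgue)"
        by (intro nn_integral_mono) (auto split: split_indicator)
      with gI True show ?thesis by simp
    qed
    then show thesis by (intro that[of "{}"]) auto
  next
    case False
    then have "0 < ?\<Phi> t" using primitive_nonneg[of "rearr lebesgue f" t] by linarith
    then have L1: "0 < L" using v0 t by (simp add: L_def)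
    obtain S where S: "S \<in> sets lebesgue"
      "ennreal L * emeasure lebesgue S \<le> ennreal (5 ^ ?n * v) * (\<integral>\<^sup>+x. g x \<partial>lebesgue)"
      "\<And>x r. x \<notin> S \<Longrightarrow> 0 < r \<Longrightarrow> r \<le> R \<Longrightarrow> (\<integral>\<^sup>+y\<in>ball x r. g y \<partial>lebesgue) \<le> ennreal (L * r ^ ?n)"
      using weak_type_covering[OF g L0, of R] unfolding v by blast
    have "ennreal L * emeasure lebesgue S \<le> ennreal (5 ^ ?n * v) * ennreal (?\<Phi> t)"
      using S(2) gI by (meson mult_left_mono order_trans zero_le)
    also have "\<dots> = ennreal L * ennreal t"
      using v0 t L0 by (simp add: ennreal_mult[symmetric] L_def)
    finally have "emeasure lebesgue S \<le> ennreal t"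
      using L1 by (simp add: ennreal_mult_le_mult_iff)
    with S show thesis by (intro that[of S])
  qed
  show thesis
  proof (rule that[OF S(1,2)])
    fix x r assume x: "x \<notin> S" and r: "0 < r" "r \<le> R"
    have "(\<integral>\<^sup>+y\<in>ball x r. e2ennreal \<bar>f y\<bar> \<partial>lebesgue) \<le> (\<integral>\<^sup>+y. \<tau> * indicator (ball x r) y + g y * indicator (ball x r) y \<partial>lebesgue)"
      using f_le by (intro nn_integral_mono) (auto split: split_indicator)
    also have "\<dots> = \<tau> * emeasure lebesgue (ball x r) + (\<integral>\<^sup>+y\<in>ball x r. g y \<partial>lebesgue)"
    proof -
      have [measurable]: "ball x r \<in> sets lebesgue" by simp
      show ?thesis
        by (subst nn_integral_add) (measurable, simp add: nn_integral_cmult_indicator)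
    qed
    also have "\<dots> \<le> ennreal (?\<Phi> t / t) * ennreal (v * r ^ ?n) + ennreal (L * r ^ ?n)"
      using r S(3)[OF x r] \<tau>_le emeasure_lebesgue_ball[of r x] unfolding v
      by (intro add_mono mult_mono) auto
    also have "\<dots> = ennreal (v * (1 + 5 ^ ?n) * (?\<Phi> t / t) * r ^ ?n)"
      using v0 r t L0 by (simp add: ennreal_mult[symmetric] ennreal_plus[symmetric] L_def algebra_simps del: ennreal_plus)
    finally show "(\<integral>\<^sup>+y\<in>ball x r. e2ennreal \<bar>f y\<bar> \<partial>lebesgue) \<le>
        ennreal (v * (1 + 5 ^ ?n) * (?\<Phi> t / t) * r ^ ?n)" .
  qed
qed

lemma rearr_wolff_potential_le:
  fixes f :: "real^'n \<Rightarrow> ereal"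
  assumes psi: "\<And>x. 0 \<le> x \<Longrightarrow> 0 \<le> \<psi> x" "mono_on {0..} \<psi>"
    and f: "f \<in> borel_measurable lebesgue"
    and fin: "\<And>s. 0 < s \<Longrightarrow> (\<integral>\<^sup>+y\<in>{0<..<s}. e2ennreal (rearr lebesgue f y) \<partial>lebesgue) < \<infinity>"
    and \<alpha>: "0 < \<alpha>" "\<alpha> < real CARD('n)" and t: "0 < t"
    and v: "v = unit_ball_vol (real CARD('n))" and \<beta>: "\<beta> = \<alpha> / real CARD('n)"
    and c: "c = 2 powr (1 - \<beta>) * (v * (1 + 5 ^ CARD('n)) * v powr (- \<beta>))"
    and K: "K = v powr (- \<beta>) * 2 powr (1 - \<beta>) / \<alpha> + v powr (- \<beta>) / real CARD('n)"
  shows "rearr lebesgue (\<lambda>x. enn2ereal (wolff_potential \<alpha> \<psi> f x)) t \<le>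
    enn2ereal (ennreal K * hardy_tail \<beta> \<psi> (\<lambda>s. c * primitive (rearr lebesgue f) s) t)"
proof -
  let ?n = "CARD('n)" and ?\<Phi> = "primitive (rearr lebesgue f)"
  have v0: "0 < v" by (simp add: v)
  have \<beta>01: "0 < \<beta>" "\<beta> < 1" using \<alpha> by (auto simp: \<beta>)
  define C where "C = v * (1 + 5 ^ ?n)"
  have C0: "0 < C" using v0 by (simp add: C_def add_pos_pos)
  define R where "R = root ?n (t / v)"
  have R: "0 < R" "v * R ^ ?n = t" using v0 t by (auto simp: R_def)
  have R\<alpha>: "R powr \<alpha> = (t / v) powr \<beta>"
  proof -
    have "R powr \<alpha> = (R ^ ?n) powr \<beta>"
      using R by (simp add: powr_realpow[symmetric] powr_powr \<beta>)
    also have "R ^ ?n = t / v" using R v0 by (auto simp: field_simps)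
    finally show ?thesis .
  qed
  have \<Phi>_mono: "mono ?\<Phi>" using fin by (rule primitive_mono)
  define m where "m x r = enn2real (\<integral>\<^sup>+y\<in>ball x r. e2ennreal \<bar>f y\<bar> \<partial>lebesgue)" for x r
  obtain S where S: "S \<in> sets lebesgue" "emeasure lebesgue S \<le> ennreal t"
    "\<And>x r. x \<notin> S \<Longrightarrow> 0 < r \<Longrightarrow> r \<le> R \<Longrightarrow> (\<integral>\<^sup>+y\<in>ball x r. e2ennreal \<bar>f y\<bar> \<partial>lebesgue) \<le>
        ennreal (C * (?\<Phi> t / t) * r ^ ?n)"
    using ball_integral_bound_off_small_set[OF f fin t v] unfolding C_def by blast
  have m_near: "m x r \<le> C * (?\<Phi> t / t) * r ^ ?n" if "x \<notin> S" "0 < r" "r \<le> R" for x r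
    unfolding m_def using S(3)[OF that] C0 t that by (intro enn2real_leI) auto
  have m_far: "m x r \<le> ?\<Phi> (v * r ^ ?n)" if "0 < r" for x r
    unfolding m_def primitive_def
  proof (rule enn2real_mono)
    show "(\<integral>\<^sup>+y\<in>ball x r. e2ennreal \<bar>f y\<bar> \<partial>lebesgue) \<le>
        (\<integral>\<^sup>+y\<in>{0<..<v * r ^ ?n}. e2ennreal (rearr lebesgue f y) \<partial>lebesgue)"
      using emeasure_lebesgue_ball[of r x] that
      by (intro nn_integral_le_rearr sigma_finite_lebesgue f) (auto simp only: v less_imp_le order_refl lmeasurable_ball fmeasurableD)
    show "(\<integral>\<^sup>+y\<in>{0<..<v * r ^ ?n}. e2ennreal (rearr lebesgue f y) \<partial>lebesgue) < top"
      using fin[of "v * r ^ ?n"] v0 that by simp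
  qed
  define H where "H = hardy_tail \<beta> \<psi> (\<lambda>s. c * ?\<Phi> s) t"
  define p where "p = \<psi> (t powr (\<beta> - 1) * (C * v powr (- \<beta>) * ?\<Phi> t))"
  have p0: "0 \<le> p" unfolding p_def using C0 by (intro psi(1)) auto
  have c_eq: "c = 2 powr (1 - \<beta>) * (C * v powr (- \<beta>))" by (simp add: c C_def)
  have near: "(\<integral>\<^sup>+r\<in>{0<..R}. ennreal (r powr (\<alpha> - 1)) * ennreal p \<partial>lebesgue) \<le>
      ennreal (v powr (- \<beta>) * 2 powr (1 - \<beta>) / \<alpha>) * H"
  proof -
    have "(\<integral>\<^sup>+r\<in>{0<..R}. ennreal (r powr (\<alpha> - 1)) * ennreal p \<partial>lebesgue) =
      (\<integral>\<^sup>+r\<in>{0<..R}. ennreal (r powr (\<alpha> - 1)) \<partial>lebesgue) * ennreal p"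
      unfolding nn_integral_completion
      by (subst nn_integral_multc[symmetric]) (auto intro!: nn_integral_cong simp: mult_ac)
    also have "\<dots> \<le> ennreal (R powr \<alpha> / \<alpha>) * ennreal p"
      using nn_integral_powr_le[of \<alpha> R] \<alpha> R by (intro mult_right_mono) auto
    also have "\<dots> = ennreal (v powr (- \<beta>) * 2 powr (1 - \<beta>) / \<alpha>) * ennreal (2 powr (\<beta> - 1) * t powr \<beta> * p)"
    proof -
      have "R powr \<alpha> / \<alpha> * p = (v powr (- \<beta>) * 2 powr (1 - \<beta>) / \<alpha>) * (2 powr (\<beta> - 1) * t powr \<beta> * p)"
        unfolding R\<alpha> using t v0 \<alpha> by (simp add: powr_divide powr_minus powr_diff field_simps)
      then show ?thesis using p0 \<alpha> by (simp add: ennreal_mult[symmetric])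
    qed
    also have "\<dots> \<le> ennreal (v powr (- \<beta>) * 2 powr (1 - \<beta>) / \<alpha>) * H"
    proof (intro mult_left_mono)
      show "ennreal (2 powr (\<beta> - 1) * t powr \<beta> * p) \<le> H"
        unfolding H_def p_def c_eq
        using hardy_tail_lower_bound[OF psi \<Phi>_mono primitive_nonneg t \<beta>01(2), of "C * v powr (- \<beta>)"] C0 by simp
    qed simp
    finally show ?thesis .
  qed
  have far: "(\<integral>\<^sup>+r\<in>{R<..}. ennreal (r powr (\<alpha> - 1) * \<psi> (r powr (\<alpha> - real ?n) * ?\<Phi> (v * r ^ ?n))) \<partial>lebesgue) \<le>
      ennreal (v powr (- \<beta>) / real ?n) * H"
  proof -
    have "v powr (1 - \<beta>) \<le> c"
    proof -
      have "v powr (1 - \<beta>) = 1 * (v * 1 * v powr (- \<beta>))" using v0 by (simp add: powr_diff powr_minus field_simps)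
      also have "\<dots> \<le> c" unfolding c using v0 \<beta>01
        by (intro mult_mono) (auto intro!: ge_one_powr_ge_zero)
      finally show ?thesis .
    qed
    then have "hardy_tail \<beta> \<psi> (\<lambda>s. v powr (1 - \<beta>) * ?\<Phi> s) t \<le> H"
      unfolding H_def using t by (intro hardy_tail_mono psi) (auto intro!: mult_right_mono)
    moreover have "(\<integral>\<^sup>+r\<in>{R<..}. ennreal (r powr (\<alpha> - 1) * \<psi> (r powr (\<alpha> - real ?n) * ?\<Phi> (v * r ^ ?n))) \<partial>lebesgue) =
      ennreal (v powr (- \<beta>) / real ?n) * hardy_tail \<beta> \<psi> (\<lambda>s. v powr (1 - \<beta>) * ?\<Phi> s) t"
      using hardy_tail_substitution[where \<psi> = \<psi> and \<Phi> = ?\<Phi> and v = v and a = R and n = ?n and \<alpha> = \<alpha>,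
        OF psi borel_measurable_mono[OF \<Phi>_mono]] v0 R by (simp add: \<beta>)
    ultimately show ?thesis by (simp add: mult_left_mono)
  qed
  have W_le: "wolff_potential \<alpha> \<psi> f x \<le> ennreal K * H" if x: "x \<notin> S" for x
  proof -
    let ?N = "\<lambda>r. ennreal (r powr (\<alpha> - 1)) * ennreal p * indicator {0<..R} r"
    let ?F = "\<lambda>r. ennreal (r powr (\<alpha> - 1) * \<psi> (r powr (\<alpha> - real ?n) * ?\<Phi> (v * r ^ ?n))) * indicator {R<..} r"
    have "wolff_potential \<alpha> \<psi> f x \<le> (\<integral>\<^sup>+r. ?N r + ?F r \<partial>lebesgue)"
      unfolding wolff_potential_def m_def[symmetric]
    proof (intro nn_integral_mono)
      fix r :: real
      consider "r \<le> 0" | "0 < r" "r \<le> R" | "0 < r" "R < r" by linarith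
      then show "ennreal (r powr (\<alpha> - 1) * \<psi> (r powr (\<alpha> - real ?n) * m x r)) * indicator {0<..} r \<le> ?N r + ?F r"
      proof cases
        case 2
        have "r powr (\<alpha> - real ?n) * m x r \<le> r powr (\<alpha> - real ?n) * (C * (?\<Phi> t / t) * r ^ ?n)"
          using m_near[OF x 2] by (intro mult_left_mono) auto
        also have "\<dots> = r powr \<alpha> * (C * (?\<Phi> t / t))"
          using 2 by (simp add: powr_diff powr_realpow)
        also have "\<dots> \<le> R powr \<alpha> * (C * (?\<Phi> t / t))"
          using 2 \<alpha> C0 t by (intro mult_right_mono powr_mono2) auto
        also have "\<dots> = t powr (\<beta> - 1) * (C * v powr (- \<beta>) * ?\<Phi> t)"
          unfolding R\<alpha> using t v0 by (simp add: powr_divide powr_minus powr_diff field_simps)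
        finally have "\<psi> (r powr (\<alpha> - real ?n) * m x r) \<le> p"
          unfolding p_def using C0 by (intro mono_onD[OF psi(2)]) (auto simp: m_def)
        then have "ennreal (r powr (\<alpha> - 1) * \<psi> (r powr (\<alpha> - real ?n) * m x r)) \<le> ennreal (r powr (\<alpha> - 1)) * ennreal p"
          using p0 by (simp add: ennreal_mult[symmetric] ennreal_leI mult_left_mono)
        with 2 show ?thesis by simp
      next
        case 3
        have "\<psi> (r powr (\<alpha> - real ?n) * m x r) \<le> \<psi> (r powr (\<alpha> - real ?n) * ?\<Phi> (v * r ^ ?n))"
          using m_far[OF 3(1), of x] by (intro mono_onD[OF psi(2)] mult_left_mono) (auto simp: m_def)
        with 3 show ?thesis by (simp add: ennreal_leI mult_left_mono)
      qed simp
    qed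
    also have "\<dots> = (\<integral>\<^sup>+r. ?N r \<partial>lebesgue) + (\<integral>\<^sup>+r. ?F r \<partial>lebesgue)"
      unfolding nn_integral_completion
    proof (rule nn_integral_add)
      have "(\<lambda>r. r powr (\<alpha> - real ?n) * ?\<Phi> (v * r ^ ?n)) \<in> borel_measurable lborel"
        using borel_measurable_mono[OF \<Phi>_mono] by measurable
      then have "(\<lambda>r. \<psi> (r powr (\<alpha> - real ?n) * ?\<Phi> (v * r ^ ?n))) \<in> borel_measurable lborel"
        by (rule borel_measurable_mono_compose[OF psi(2)]) simp
      then show "?F \<in> borel_measurable lborel"
        by (intro borel_measurable_times_ennreal measurable_compose[OF borel_measurable_times measurable_ennreal]) auto
    qed measurable
    also have "\<dots> \<le> ennreal (v powr (- \<beta>) * 2 powr (1 - \<beta>) / \<alpha>) * H + ennreal (v powr (- \<beta>) / real ?n) * H"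
      by (intro add_mono near far)
    also have "\<dots> = ennreal K * H"
      unfolding K using \<alpha> by (simp add: distrib_right)
    finally show ?thesis .
  qed
  let ?W = "\<lambda>x. enn2ereal (wolff_potential \<alpha> \<psi> f x)"
  have W_meas: "?W \<in> borel_measurable lebesgue"
    by (intro measurable_compose[OF borel_measurable_wolff_potential[OF psi(2) f] measurable_enn2ereal])
  have "distrib lebesgue ?W (ennreal K * H) \<le> emeasure lebesgue S"
    unfolding distrib_def
  proof (rule emeasure_mono[OF _ S(1)], rule subsetI)
    fix x assume "x \<in> {x \<in> space lebesgue. enn2ereal (ennreal K * H) < \<bar>?W x\<bar>}"
    then have "ennreal K * H < wolff_potential \<alpha> \<psi> f x" by (simp add: less_ennreal.rep_eq)
    with W_le[of x] show "x \<in> S" by (auto simp: not_le[symmetric])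
  qed
  also have "\<dots> \<le> ennreal t" by (rule S(2))
  finally have "\<not> enn2ereal (ennreal K * H) < rearr lebesgue ?W t"
    using less_rearr_iff[OF W_meas, of "ennreal K * H" t] by simp
  then show ?thesis by (simp add: H_def)
qed

lemma borel_measurable_hardy_tail:
  assumes "mono_on {0..} \<psi>" "\<Phi> \<in> borel_measurable borel" "\<And>s. 0 \<le> \<Phi> s"
  shows "hardy_tail \<beta> \<psi> \<Phi> \<in> borel_measurable borel"
proof -
  note [measurable] = assms(2)
  define P where "P s = \<psi> (s powr (\<beta> - 1) * \<Phi> s)" for s
  have "(\<lambda>s. s powr (\<beta> - 1) * \<Phi> s) \<in> borel_measurable lborel" by measurable
  then have [measurable]: "P \<in> borel_measurable lborel"
    unfolding P_def by (rule borel_measurable_mono_compose[OF assms(1)]) (simp add: assms(3))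
  have "(\<lambda>t. \<integral>\<^sup>+s. ennreal (s powr (\<beta> - 1) * P s) * indicator {z. fst z < snd z} (t, s) \<partial>lborel) \<in> borel_measurable borel"
    unfolding indicator_def by measurable
  moreover have "hardy_tail \<beta> \<psi> \<Phi> = (\<lambda>t. \<integral>\<^sup>+s. ennreal (s powr (\<beta> - 1) * P s) * indicator {z. fst z < snd z} (t, s) \<partial>lborel)"
    unfolding hardy_tail_def nn_integral_completion P_def
    by (intro ext nn_integral_cong) (auto split: split_indicator)
  ultimately show ?thesis by simp
qed

lemma nn_integral_interval_half_line:
  "(\<integral>\<^sup>+y\<in>{0<..<s}. g y \<partial>half_line) = (\<integral>\<^sup>+y\<in>{0<..<s}. g y \<partial>lebesgue)"
  by (subst nn_integral_restrict_space) (auto intro!: nn_integral_cong split: split_indicator)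

lemma interval_half_line:
  "{0<..<s} \<in> sets half_line" "emeasure half_line {0<..<s} \<le> ennreal s"
proof -
  show sets: "{0<..<s} \<in> sets half_line"
    by (auto simp: sets_restrict_space image_iff intro!: exI[of _ "{0<..<s}"])
  have "emeasure half_line {0<..<s} = emeasure lebesgue {0<..<s}"
    by (rule emeasure_restrict_space) auto
  then show "emeasure half_line {0<..<s} \<le> ennreal s"
    by (cases "0 \<le> s") auto
qed

lemma nn_integral_fun_space_finite:
  assumes N: "quasi_normed_function_space half_line N" and \<phi>: "\<phi> \<in> fun_space half_line N"
    and nonneg: "\<And>t. 0 < t \<Longrightarrow> 0 \<le> \<phi> t"
  shows "(\<integral>\<^sup>+y\<in>{0<..<s}. e2ennreal (\<phi> y) \<partial>lebesgue) < \<infinity>"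
proof -
  have "(\<integral>\<^sup>+y\<in>{0<..<s}. e2ennreal \<bar>\<phi> y\<bar> \<partial>half_line) < \<infinity>"
    using interval_half_line[of s] by (intro quasi_norm_integral[OF N _ _ \<phi>]) (auto intro: le_less_trans)
  also have "(\<integral>\<^sup>+y\<in>{0<..<s}. e2ennreal \<bar>\<phi> y\<bar> \<partial>half_line) = (\<integral>\<^sup>+y\<in>{0<..<s}. e2ennreal (\<phi> y) \<partial>lebesgue)"
    unfolding nn_integral_interval_half_line using nonneg
    by (intro nn_integral_cong) (auto split: split_indicator)
  finally show ?thesis .
qed

lemma primitive_le_rearr:
  assumes \<phi>: "\<phi> \<in> borel_measurable half_line" and nonneg: "\<And>t. 0 < t \<Longrightarrow> 0 \<le> \<phi> t"
    and fin: "(\<integral>\<^sup>+y\<in>{0<..<s}. e2ennreal (rearr half_line \<phi> y) \<partial>lebesgue) < \<infinity>"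
  shows "primitive \<phi> s \<le> primitive (rearr half_line \<phi>) s"
  unfolding primitive_def
proof (rule enn2real_mono)
  have "(\<integral>\<^sup>+y\<in>{0<..<s}. e2ennreal (\<phi> y) \<partial>lebesgue) = (\<integral>\<^sup>+y\<in>{0<..<s}. e2ennreal \<bar>\<phi> y\<bar> \<partial>half_line)"
    unfolding nn_integral_interval_half_line using nonneg
    by (intro nn_integral_cong) (auto split: split_indicator)
  also have "\<dots> \<le> (\<integral>\<^sup>+y\<in>{0<..<s}. e2ennreal (rearr half_line \<phi> y) \<partial>lebesgue)"
    by (intro nn_integral_le_rearr sigma_finite_half_line \<phi> interval_half_line)
  finally show "(\<integral>\<^sup>+y\<in>{0<..<s}. e2ennreal (\<phi> y) \<partial>lebesgue) \<le>
      (\<integral>\<^sup>+y\<in>{0<..<s}. e2ennreal (rearr half_line \<phi> y) \<partial>lebesgue)" .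
qed (use fin in simp)

lemma rearr_le_of_antimono:
  assumes g: "g \<in> borel_measurable half_line" "\<And>s t. 0 < s \<Longrightarrow> s \<le> t \<Longrightarrow> g t \<le> g s"
    "\<And>t. 0 \<le> g t" and t: "0 < t"
  shows "rearr half_line g t \<le> g t"
proof -
  have ea: "enn2ereal (e2ennreal (g t)) = g t" using g(3) by (simp add: enn2ereal_e2ennreal)
  have "{s. 0 < s \<and> g t < \<bar>g s\<bar>} \<subseteq> {0<..<t}"
    using g(2)[OF t] g(3) by (force simp: not_less[symmetric])
  then have "distrib half_line g (e2ennreal (g t)) \<le> emeasure lebesgue {0<..<t}"
    unfolding distrib_half_line ea by (rule emeasure_mono) simp
  then have "\<not> enn2ereal (e2ennreal (g t)) < rearr half_line g t"
    using t by (subst less_rearr_iff[OF g(1)]) (simp add: not_less)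
  then show ?thesis by (simp add: ea)
qed

lemma ereal_times_enn2ereal: "0 \<le> a \<Longrightarrow> ereal a * enn2ereal y = enn2ereal (ennreal a * y)"
  by (simp add: times_ennreal.rep_eq)

section \<open>The two inequalities\<close>

lemma fun_space_scale:
  assumes "quasi_normed_function_space M N" "f \<in> fun_space M N"
  shows "(\<lambda>x. ereal c * f x) \<in> fun_space M N"
proof -
  have f: "f \<in> borel_measurable M" "N f < \<infinity>" using assms(2) by (auto simp: fun_space_def)
  then have "N (\<lambda>x. ereal c * f x) < \<infinity>"
    by (simp add: quasi_norm_scale[OF assms(1)] ennreal_mult_less_top)
  moreover have "(\<lambda>x. ereal c * f x) \<in> borel_measurable M" using f(1) by measurable
  ultimately show ?thesis by (simp add: fun_space_def)
qed

lemma fun_space_mono: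
  assumes "quasi_normed_function_space M N" "f \<in> fun_space M N" "g \<in> borel_measurable M"
    "\<And>x. x \<in> space M \<Longrightarrow> \<bar>g x\<bar> \<le> \<bar>f x\<bar>"
  shows "g \<in> fun_space M N"
proof -
  have "N g \<le> N f"
    using assms by (intro quasi_norm_mono[OF assms(1)] AE_I2) (auto simp: fun_space_def)
  with assms show ?thesis by (auto simp: fun_space_def)
qed

lemma rearr_fun_space_iff:
  fixes f :: "real^'n \<Rightarrow> ereal"
  assumes "ri_space lebesgue N" "representation_space N Nb" "f \<in> borel_measurable lebesgue"
  shows "rearr lebesgue f \<in> fun_space half_line Nb \<longleftrightarrow> f \<in> fun_space lebesgue N"
  using representation_norm[OF assms] borel_measurable_half_line[OF borel_measurable_rearr[OF assms(3)]] assms(3)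
  by (simp add: fun_space_def)

lemma rearr_half_line_fun_space_iff:
  assumes "ri_space half_line N" "f \<in> borel_measurable half_line"
  shows "rearr half_line f \<in> fun_space half_line N \<longleftrightarrow> f \<in> fun_space half_line N"
  using ri_norm_half_line[OF assms] borel_measurable_half_line[OF borel_measurable_rearr[OF assms(2)]] assms(2)
  by (simp add: fun_space_def)

lemma rearr_eq_0_outside:
  assumes "f \<in> borel_measurable M" "\<Omega> \<in> sets M" "\<And>x. x \<in> space M - \<Omega> \<Longrightarrow> f x = 0"
    "emeasure M \<Omega> \<le> ennreal t"
  shows "rearr M f t = 0"
proof -
  have "distrib M f 0 \<le> emeasure M \<Omega>"
    unfolding distrib_def
  proof (rule emeasure_mono[OF _ assms(2)], rule subsetI)
    fix x assume "x \<in> {x \<in> space M. enn2ereal 0 < \<bar>f x\<bar>}"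
    with assms(3)[of x] show "x \<in> \<Omega>" by (cases "x \<in> \<Omega>") (auto simp: zero_ennreal.rep_eq)
  qed
  then have "\<not> enn2ereal 0 < rearr M f t"
    using assms(4) less_rearr_iff[OF assms(1), of 0 t] by (auto simp: not_less)
  then show ?thesis using rearr_nonneg[of M f t] by (simp add: zero_ennreal.rep_eq)
qed

lemma potential_inequality_if_hardy_inequality:
  fixes NX NY :: "(real^'n) functional"
  assumes psi: "\<And>x. 0 \<le> x \<Longrightarrow> 0 \<le> \<psi> x" "mono_on {0..} \<psi>"
    and alpha: "0 < \<alpha>" "\<alpha> < real CARD('n)"
    and X: "ri_space lebesgue NX" and Y: "ri_space lebesgue NY"
    and Xb: "representation_space NX NXb" and Yb: "representation_space NY NYb"
    and a_X: "\<And>f. f \<in> fun_space lebesgue NX \<Longrightarrow> TX f = TXb (rearr lebesgue f)"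
    and a_Y: "\<And>f. f \<in> fun_space lebesgue NY \<Longrightarrow> TY f = TYb (rearr lebesgue f)"
    and c_Y: "\<And>\<phi>1 \<phi>2. \<phi>1 \<in> fun_space half_line NYb \<Longrightarrow> \<phi>2 \<in> fun_space half_line NYb \<Longrightarrow>
                (\<forall>t>0. 0 \<le> \<phi>1 t \<and> \<phi>1 t \<le> \<phi>2 t) \<Longrightarrow> TYb \<phi>1 \<le> TYb \<phi>2"
    and Omega: "\<Omega> \<in> sets lebesgue"
    and hardy: "hardy_inequality \<alpha> \<psi> NXb NYb TXb TYb \<Omega>"
  shows "potential_inequality \<alpha> \<psi> NX NY TX TY \<Omega>"
  unfolding potential_inequality_def Let_def
proof (intro allI impI)
  fix k :: real assume k: "0 < k"
  define v where "v = unit_ball_vol (real CARD('n))"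
  define \<beta> where "\<beta> = \<alpha> / real CARD('n)"
  define c0 where "c0 = 2 powr (1 - \<beta>) * (v * (1 + 5 ^ CARD('n)) * v powr (- \<beta>))"
  define K where "K = v powr (- \<beta>) * 2 powr (1 - \<beta>) / \<alpha> + v powr (- \<beta>) / real CARD('n)"
  have v0: "0 < v" by (simp add: v_def)
  have c0: "0 < c0" unfolding c0_def using v0 by (simp add: add_pos_pos)
  have K: "0 < K" unfolding K_def using v0 alpha by (intro add_pos_pos) auto
  have qXb: "quasi_normed_function_space half_line NXb" and qYb: "quasi_normed_function_space half_line NYb"
    and qX: "quasi_normed_function_space lebesgue NX"
    using Xb Yb X by (auto simp: representation_space_def ri_space_def)
  have kK: "0 < k * K" using k K by simp
  obtain c1 where c1: "0 < c1"
    and H: "\<forall>\<phi>\<in>fun_space_on half_line NXb {t. 0 < t \<and> ennreal t < emeasure lebesgue \<Omega>}. (\<forall>t>0. 0 \<le> \<phi> t) \<longrightarrow>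
      (\<lambda>t. ereal (k * K) * enn2ereal (hardy_operator \<beta> \<psi> \<phi> t)) \<in> fun_space half_line NYb \<and>
      TYb (\<lambda>t. ereal (k * K) * enn2ereal (hardy_operator \<beta> \<psi> \<phi> t)) \<le> TXb (\<lambda>t. ereal c1 * \<phi> t)"
    using hardy[unfolded hardy_inequality_def Let_def, folded \<beta>_def, rule_format, OF kK] by auto
  show "\<exists>c>0. \<forall>f\<in>fun_space_on lebesgue NX \<Omega>.
      (\<lambda>x. ereal k * enn2ereal (wolff_potential \<alpha> \<psi> f x)) \<in> fun_space lebesgue NY \<and>
      TY (\<lambda>x. ereal k * enn2ereal (wolff_potential \<alpha> \<psi> f x)) \<le> TX (\<lambda>x. ereal c * f x)"
  proof (intro exI[of _ "c1 * c0"] conjI ballI)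
    show "0 < c1 * c0" using c1 c0 by simp
    fix f assume f_on: "f \<in> fun_space_on lebesgue NX \<Omega>"
    then have fX: "f \<in> fun_space lebesgue NX" and f_zero: "\<And>x. x \<in> space lebesgue - \<Omega> \<Longrightarrow> f x = 0"
      by (auto simp: fun_space_on_def)
    have f: "f \<in> borel_measurable lebesgue" using fX by (simp add: fun_space_def)
    have rf: "rearr lebesgue f \<in> fun_space half_line NXb"
      using fX by (simp only: rearr_fun_space_iff[OF X Xb f])
    have fin: "(\<integral>\<^sup>+y\<in>{0<..<s}. e2ennreal (rearr lebesgue f y) \<partial>lebesgue) < \<infinity>" for s
      by (rule nn_integral_fun_space_finite[OF qXb rf rearr_nonneg])
    define \<phi> where "\<phi> t = ereal c0 * rearr lebesgue f t" for t
    have \<phi>_eq: "\<phi> = (\<lambda>t. ereal c0 * rearr lebesgue f t)" by (simp add: \<phi>_def fun_eq_iff)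
    have \<phi>_on: "\<phi> \<in> fun_space_on half_line NXb {t. 0 < t \<and> ennreal t < emeasure lebesgue \<Omega>}"
      unfolding fun_space_on_def
    proof (intro CollectI conjI ballI)
      show "\<phi> \<in> fun_space half_line NXb" unfolding \<phi>_eq by (rule fun_space_scale[OF qXb rf])
      fix t assume "t \<in> space half_line - {t. 0 < t \<and> ennreal t < emeasure lebesgue \<Omega>}"
      then have "rearr lebesgue f t = 0"
        by (intro rearr_eq_0_outside[OF f Omega f_zero]) (auto simp: not_less)
      then show "\<phi> t = 0" by (simp add: \<phi>_def)
    qed
    define u where "u t = ereal (k * K) * enn2ereal (hardy_operator \<beta> \<psi> \<phi> t)" for t
    have u_eq: "u = (\<lambda>t. ereal (k * K) * enn2ereal (hardy_operator \<beta> \<psi> \<phi> t))" by (simp add: u_def fun_eq_iff)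
    have "\<forall>t>0. 0 \<le> \<phi> t" using c0 by (simp add: \<phi>_def)
    from H[rule_format, OF \<phi>_on] this have u: "u \<in> fun_space half_line NYb" "TYb u \<le> TXb (\<lambda>t. ereal c1 * \<phi> t)"
      unfolding u_eq by auto
    have hardy_eq: "hardy_operator \<beta> \<psi> \<phi> = hardy_tail \<beta> \<psi> (\<lambda>s. c0 * primitive (rearr lebesgue f) s)"
      unfolding hardy_operator_hardy_tail \<phi>_eq
      by (intro arg_cong[where f = "hardy_tail \<beta> \<psi>"] ext primitive_scale[OF _ c0]
          borel_measurable_half_line borel_measurable_rearr f)
    define W where "W x = enn2ereal (wolff_potential \<alpha> \<psi> f x)" for x
    have W: "W \<in> borel_measurable lebesgue"
      unfolding W_def by (rule measurable_compose[OF borel_measurable_wolff_potential[OF psi(2) f] measurable_enn2ereal])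
    let ?w = "\<lambda>x. ereal k * W x"
    have w: "?w \<in> borel_measurable lebesgue" using W by measurable
    have le: "rearr lebesgue ?w t \<le> u t" if "0 < t" for t
    proof -
      have "rearr lebesgue W t \<le> enn2ereal (ennreal K * hardy_operator \<beta> \<psi> \<phi> t)"
        unfolding W_def hardy_eq
        by (rule rearr_wolff_potential_le[OF psi f fin alpha that v_def \<beta>_def c0_def K_def])
      then have "ereal k * rearr lebesgue W t \<le> ereal k * enn2ereal (ennreal K * hardy_operator \<beta> \<psi> \<phi> t)"
        using k by (intro ereal_mult_left_mono) auto
      also have "\<dots> = u t"
        unfolding u_def using k K by (simp add: ereal_times_enn2ereal ennreal_mult mult.assoc)
      finally show ?thesis by (simp only: rearr_scale[OF W k])
    qed
    have rw: "rearr lebesgue ?w \<in> fun_space half_line NYb"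
    proof (rule fun_space_mono[OF qYb u(1)])
      show "rearr lebesgue ?w \<in> borel_measurable half_line"
        by (intro borel_measurable_half_line borel_measurable_rearr w)
      fix t assume "t \<in> space half_line"
      then show "\<bar>rearr lebesgue ?w t\<bar> \<le> \<bar>u t\<bar>"
        using le[of t] order_trans[OF rearr_nonneg le, of t] by simp
    qed
    then have wY: "?w \<in> fun_space lebesgue NY" by (simp only: rearr_fun_space_iff[OF Y Yb w])
    then show "(\<lambda>x. ereal k * enn2ereal (wolff_potential \<alpha> \<psi> f x)) \<in> fun_space lebesgue NY"
      by (simp only: W_def)
    have "TY ?w = TYb (rearr lebesgue ?w)" by (rule a_Y[OF wY])
    also have "\<dots> \<le> TYb u" using le by (intro c_Y[OF rw u(1)]) simp
    also have "\<dots> \<le> TXb (\<lambda>t. ereal c1 * \<phi> t)" by (rule u(2))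
    also have "(\<lambda>t. ereal c1 * \<phi> t) = rearr lebesgue (\<lambda>x. ereal (c1 * c0) * f x)"
      using c0 c1 by (simp add: rearr_scale[OF f] \<phi>_def mult.assoc[symmetric])
    also have "TXb \<dots> = TX (\<lambda>x. ereal (c1 * c0) * f x)"
      by (rule a_X[symmetric, OF fun_space_scale[OF qX fX]])
    finally show "TY (\<lambda>x. ereal k * enn2ereal (wolff_potential \<alpha> \<psi> f x)) \<le> TX (\<lambda>x. ereal (c1 * c0) * f x)"
      by (simp only: W_def)
  qed
qed

lemma hardy_inequality_if_potential_inequality:
  fixes NX NY :: "(real^'n) functional"
  assumes psi: "\<And>x. 0 \<le> x \<Longrightarrow> 0 \<le> \<psi> x" "mono_on {0..} \<psi>"
    and X: "ri_space lebesgue NX" and Y: "ri_space lebesgue NY"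
    and Xb: "representation_space NX NXb" and Yb: "representation_space NY NYb"
    and a_X: "\<And>f. f \<in> fun_space lebesgue NX \<Longrightarrow> TX f = TXb (rearr lebesgue f)"
    and a_Y: "\<And>f. f \<in> fun_space lebesgue NY \<Longrightarrow> TY f = TYb (rearr lebesgue f)"
    and b_X: "\<And>\<phi>. \<phi> \<in> fun_space half_line NXb \<Longrightarrow> (\<forall>t>0. 0 \<le> \<phi> t) \<Longrightarrow>
                TXb \<phi> = TXb (rearr half_line \<phi>)"
    and b_Y: "\<And>\<phi>. \<phi> \<in> fun_space half_line NYb \<Longrightarrow> (\<forall>t>0. 0 \<le> \<phi> t) \<Longrightarrow>
                TYb \<phi> = TYb (rearr half_line \<phi>)"
    and c_Y: "\<And>\<phi>1 \<phi>2. \<phi>1 \<in> fun_space half_line NYb \<Longrightarrow> \<phi>2 \<in> fun_space half_line NYb \<Longrightarrow>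
                (\<forall>t>0. 0 \<le> \<phi>1 t \<and> \<phi>1 t \<le> \<phi>2 t) \<Longrightarrow> TYb \<phi>1 \<le> TYb \<phi>2"
    and potential: "potential_inequality \<alpha> \<psi> NX NY TX TY UNIV"
  shows "hardy_inequality \<alpha> \<psi> NXb NYb TXb TYb (\<Omega> :: (real^'n) set)"
  unfolding hardy_inequality_def Let_def
proof (intro allI impI)
  fix k :: real assume k: "0 < k"
  define v where "v = unit_ball_vol (real CARD('n))"
  define \<beta> where "\<beta> = \<alpha> / real CARD('n)"
  define w where "w = v / 2 ^ CARD('n)"
  define \<kappa> where "\<kappa> = w powr (1 - \<beta>)"
  define K where "K = w powr (- \<beta>) / real CARD('n)"
  have v0: "0 < v" by (simp add: v_def)
  have w0: "0 < w" using v0 by (simp add: w_def)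
  have \<kappa>: "0 < \<kappa>" and K: "0 < K" using w0 by (simp_all add: \<kappa>_def K_def)
  have rXb: "ri_space half_line NXb" and rYb: "ri_space half_line NYb"
    using Xb Yb by (auto simp: representation_space_def)
  then have qXb: "quasi_normed_function_space half_line NXb" and qYb: "quasi_normed_function_space half_line NYb"
    and qX: "quasi_normed_function_space lebesgue NX" and qY: "quasi_normed_function_space lebesgue NY"
    using X Y by (auto simp: ri_space_def)
  have "0 < k / K" using k K by simp
  with potential obtain c1 where c1: "0 < c1"
    and P: "\<And>f. f \<in> fun_space lebesgue NX \<Longrightarrow>
      (\<lambda>x. ereal (k / K) * enn2ereal (wolff_potential \<alpha> \<psi> f x)) \<in> fun_space lebesgue NY \<and>
      TY (\<lambda>x. ereal (k / K) * enn2ereal (wolff_potential \<alpha> \<psi> f x)) \<le> TX (\<lambda>x. ereal c1 * f x)"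
    unfolding potential_inequality_def Let_def fun_space_on_def by auto
  show "\<exists>c>0. \<forall>\<phi>\<in>fun_space_on half_line NXb {t. 0 < t \<and> ennreal t < emeasure lebesgue \<Omega>}.
      (\<forall>t>0. 0 \<le> \<phi> t) \<longrightarrow>
      (\<lambda>t. ereal k * enn2ereal (hardy_operator (\<alpha> / real CARD('n)) \<psi> \<phi> t)) \<in> fun_space half_line NYb \<and>
      TYb (\<lambda>t. ereal k * enn2ereal (hardy_operator (\<alpha> / real CARD('n)) \<psi> \<phi> t)) \<le> TXb (\<lambda>t. ereal c * \<phi> t)"
    unfolding \<beta>_def[symmetric]
  proof (intro exI[of _ "c1 * (1 / \<kappa>)"] conjI ballI impI)
    show "0 < c1 * (1 / \<kappa>)" using c1 \<kappa> by simp
    fix \<phi> assume "\<phi> \<in> fun_space_on half_line NXb {t. 0 < t \<and> ennreal t < emeasure lebesgue \<Omega>}"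
      and \<phi>0: "\<forall>t>0. 0 \<le> \<phi> t"
    then have \<phi>X: "\<phi> \<in> fun_space half_line NXb" by (simp add: fun_space_on_def)
    then have \<phi>: "\<phi> \<in> borel_measurable half_line" by (simp add: fun_space_def)
    let ?\<phi>1 = "\<lambda>t. ereal (1 / \<kappa>) * \<phi> t"
    have \<kappa>': "0 < 1 / \<kappa>" using \<kappa> by simp
    have \<phi>1X: "?\<phi>1 \<in> fun_space half_line NXb" by (rule fun_space_scale[OF qXb \<phi>X])
    then have \<phi>1: "?\<phi>1 \<in> borel_measurable half_line" by (simp add: fun_space_def)
    have r\<phi>X: "rearr half_line \<phi> \<in> fun_space half_line NXb"
      using \<phi>X by (simp only: rearr_half_line_fun_space_iff[OF rXb \<phi>])
    have r\<phi>1X: "rearr half_line ?\<phi>1 \<in> fun_space half_line NXb"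
      using \<phi>1X by (simp only: rearr_half_line_fun_space_iff[OF rXb \<phi>1])
    have r\<phi>: "rearr half_line \<phi> \<in> borel_measurable half_line" using r\<phi>X by (simp add: fun_space_def)
    have fin: "(\<integral>\<^sup>+y\<in>{0<..<s}. e2ennreal (\<phi> y) \<partial>lebesgue) < \<infinity>" for s
      using \<phi>0 by (intro nn_integral_fun_space_finite[OF qXb \<phi>X]) simp
    have finr: "(\<integral>\<^sup>+y\<in>{0<..<s}. e2ennreal (rearr half_line \<phi> y) \<partial>lebesgue) < \<infinity>" for s
      by (rule nn_integral_fun_space_finite[OF qXb r\<phi>X rearr_nonneg])
    have finr1: "(\<integral>\<^sup>+y\<in>{0<..<s}. e2ennreal (rearr half_line ?\<phi>1 y) \<partial>lebesgue) < \<infinity>" for s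
      by (rule nn_integral_fun_space_finite[OF qXb r\<phi>1X rearr_nonneg])

    define f :: "real^'n \<Rightarrow> ereal" where "f = radial (rearr half_line ?\<phi>1)"
    have f: "f \<in> borel_measurable lebesgue"
      unfolding f_def by (rule lebesgue_measurable_radial_rearr[OF \<phi>1])
    have rf: "rearr lebesgue f = rearr half_line ?\<phi>1"
      unfolding f_def by (rule rearr_radial_rearr[OF \<phi>1])
    have fX: "f \<in> fun_space lebesgue NX"
      using r\<phi>1X unfolding rf[symmetric] by (simp only: rearr_fun_space_iff[OF X Xb f])
    define u where "u x = ereal (k / K) * enn2ereal (wolff_potential \<alpha> \<psi> f x)" for x
    have uY: "u \<in> fun_space lebesgue NY" and u_le: "TY u \<le> TX (\<lambda>x. ereal c1 * f x)"
      using P[OF fX] unfolding u_def by auto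
    then have u: "u \<in> borel_measurable lebesgue" by (simp add: fun_space_def)
    have u0: "0 \<le> u x" for x using k K by (simp add: u_def)

    define g where "g t = ereal k * enn2ereal (hardy_operator \<beta> \<psi> (rearr half_line \<phi>) t)" for t
    have g0: "0 \<le> g t" for t using k by (simp add: g_def)
    have hardy_meas: "hardy_operator \<beta> \<psi> \<phi>' \<in> borel_measurable half_line"
      if "\<And>s. (\<integral>\<^sup>+y\<in>{0<..<s}. e2ennreal (\<phi>' y) \<partial>lebesgue) < \<infinity>" for \<phi>'
      unfolding hardy_operator_hardy_tail
      by (intro borel_measurable_half_line borel_measurable_hardy_tail psi(2) primitive_nonneg
          borel_measurable_mono primitive_mono that)
    have g: "g \<in> borel_measurable half_line"
      unfolding g_def using hardy_meas[OF finr] by measurable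
    have g_antimono: "g t \<le> g s" if "0 < s" "s \<le> t" for s t
    proof -
      have "enn2ereal (hardy_operator \<beta> \<psi> (rearr half_line \<phi>) t) \<le> enn2ereal (hardy_operator \<beta> \<psi> (rearr half_line \<phi>) s)"
        unfolding hardy_operator_hardy_tail less_eq_ennreal.rep_eq[symmetric] by (rule hardy_tail_antimono[OF that(2)])
      then show ?thesis unfolding g_def using k by (intro ereal_mult_left_mono) auto
    qed
    define h :: "real^'n \<Rightarrow> ereal" where "h = radial (rearr half_line g)"
    have h: "h \<in> borel_measurable lebesgue"
      unfolding h_def by (rule lebesgue_measurable_radial_rearr[OF g])
    have rh: "rearr lebesgue h = rearr half_line g"
      unfolding h_def by (rule rearr_radial_rearr[OF g])
    have h0: "0 \<le> h x" for x unfolding h_def by (simp add: radial_nonneg)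
    have hu: "h x \<le> u x" for x
    proof (cases "x = 0")
      case True
      then show ?thesis using u0[of x] by (simp add: h_def radial_def)
    next
      case False
      let ?t = "v * norm x ^ CARD('n)"
      have t: "0 < ?t" using v0 False by simp
      have "h x = rearr half_line g ?t" using False by (simp add: h_def radial_def v_def)
      also have "\<dots> \<le> g ?t" by (rule rearr_le_of_antimono[OF g g_antimono g0 t])
      also have "\<dots> = ereal (k / K) * enn2ereal (ennreal K * hardy_operator \<beta> \<psi> (rearr half_line \<phi>) ?t)"
        unfolding g_def using k K by (simp add: ereal_times_enn2ereal mult.assoc[symmetric] ennreal_mult[symmetric])
      also have "\<dots> \<le> u x"
      proof -
        have eq: "(\<lambda>s. w powr (1 - \<beta>) * primitive (rearr half_line ?\<phi>1) s) = primitive (rearr half_line \<phi>)"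
          using \<kappa> unfolding rearr_scale[OF \<phi> \<kappa>'] primitive_scale[OF r\<phi> \<kappa>'] \<kappa>_def[symmetric] by simp
        have "ennreal K * hardy_operator \<beta> \<psi> (rearr half_line \<phi>) ?t \<le> wolff_potential \<alpha> \<psi> f x"
          using wolff_radial_lower_bound[OF psi \<phi>1 finr1 v_def w_def \<beta>_def, of x]
          unfolding eq K_def f_def hardy_operator_hardy_tail .
        then show ?thesis
          unfolding u_def using k K by (intro ereal_mult_left_mono) (auto simp: less_eq_ennreal.rep_eq[symmetric])
      qed
      finally show ?thesis .
    qed
    have hY: "h \<in> fun_space lebesgue NY"
      using h0 hu u0 by (intro fun_space_mono[OF qY uY h]) simp
    have rhY: "rearr lebesgue h \<in> fun_space half_line NYb"
      using hY by (simp only: rearr_fun_space_iff[OF Y Yb h])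
    have ruY: "rearr lebesgue u \<in> fun_space half_line NYb"
      using uY by (simp only: rearr_fun_space_iff[OF Y Yb u])
    have gY: "g \<in> fun_space half_line NYb"
      using rhY unfolding rh by (simp only: rearr_half_line_fun_space_iff[OF rYb g])
    have "TYb g = TYb (rearr lebesgue h)"
      unfolding rh using g0 by (intro b_Y[OF gY]) simp
    also have "\<dots> \<le> TYb (rearr lebesgue u)"
    proof (rule c_Y[OF rhY ruY], intro allI impI conjI rearr_nonneg)
      fix t :: real
      show "rearr lebesgue h t \<le> rearr lebesgue u t"
        using h0 hu u0 by (intro rearr_mono distrib_mono u AE_I2) simp
    qed
    also have "\<dots> = TY u" by (rule a_Y[OF uY, symmetric])
    also have "\<dots> \<le> TX (\<lambda>x. ereal c1 * f x)" by (rule u_le)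
    also have "\<dots> = TXb (rearr lebesgue (\<lambda>x. ereal c1 * f x))"
      by (rule a_X[OF fun_space_scale[OF qX fX]])
    also have "rearr lebesgue (\<lambda>x. ereal c1 * f x) = rearr half_line (\<lambda>t. ereal (c1 * (1 / \<kappa>)) * \<phi> t)"
      using c1 \<kappa> unfolding rearr_scale[OF f c1] rf
      by (subst (1 2) rearr_scale[OF \<phi>]) (simp_all add: mult.assoc[symmetric])
    also have "TXb \<dots> = TXb (\<lambda>t. ereal (c1 * (1 / \<kappa>)) * \<phi> t)"
      using c1 \<kappa> \<phi>0 by (intro b_X[symmetric] fun_space_scale[OF qXb \<phi>X]) simp
    finally have g_le: "TYb g \<le> TXb (\<lambda>t. ereal (c1 * (1 / \<kappa>)) * \<phi> t)" .

    let ?q = "\<lambda>t. ereal k * enn2ereal (hardy_operator \<beta> \<psi> \<phi> t)"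
    have q0: "0 \<le> ?q t" for t using k by simp
    have qg: "?q t \<le> g t" if "0 < t" for t
    proof -
      have "hardy_operator \<beta> \<psi> \<phi> t \<le> hardy_operator \<beta> \<psi> (rearr half_line \<phi>) t"
        unfolding hardy_operator_hardy_tail using that \<phi>0
        by (intro hardy_tail_mono psi(2) conjI primitive_nonneg primitive_le_rearr \<phi> finr) auto
      then show ?thesis
        unfolding g_def using k by (intro ereal_mult_left_mono) (auto simp: less_eq_ennreal.rep_eq[symmetric])
    qed
    show qY: "?q \<in> fun_space half_line NYb"
    proof (rule fun_space_mono[OF qYb gY])
      show "?q \<in> borel_measurable half_line" using hardy_meas[OF fin] by measurable
      show "\<bar>?q t\<bar> \<le> \<bar>g t\<bar>" if "t \<in> space half_line" for t
        using qg[of t] q0[of t] g0[of t] that by simp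
    qed
    have "TYb ?q \<le> TYb g" using qg q0 by (intro c_Y[OF qY gY]) simp
    then show "TYb ?q \<le> TXb (\<lambda>t. ereal (c1 * (1 / \<kappa>)) * \<phi> t)" using g_le by (rule order_trans)
  qed
qed

theorem theorem3:
  fixes \<psi> :: "real \<Rightarrow> real" and \<alpha> :: real
    and NX NY :: "(real^'n) functional"
    and NXb NYb :: "real functional"
    and TX TY :: "(real^'n \<Rightarrow> ereal) \<Rightarrow> real"
    and TXb TYb :: "(real \<Rightarrow> ereal) \<Rightarrow> real"
    and \<Omega> :: "(real^'n) set"
  assumes psi_nonneg: "\<And>x. 0 \<le> x \<Longrightarrow> 0 \<le> \<psi> x"
    and psi_mono: "mono_on {0..} \<psi>"
    and psi_left_cont: "\<And>x. 0 < x \<Longrightarrow> continuous (at_left x) \<psi>"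
    and alpha: "0 < \<alpha>" "\<alpha> < real CARD('n)"
    and X: "ri_space lebesgue NX" and Y: "ri_space lebesgue NY"
    and Xb: "representation_space NX NXb" and Yb: "representation_space NY NYb"
    and TX_nonneg: "\<And>f. f \<in> fun_space lebesgue NX \<Longrightarrow> 0 \<le> TX f"
    and TY_nonneg: "\<And>f. f \<in> fun_space lebesgue NY \<Longrightarrow> 0 \<le> TY f"
    and TXb_nonneg: "\<And>\<phi>. \<phi> \<in> fun_space half_line NXb \<Longrightarrow> 0 \<le> TXb \<phi>"
    and TYb_nonneg: "\<And>\<phi>. \<phi> \<in> fun_space half_line NYb \<Longrightarrow> 0 \<le> TYb \<phi>"
    and a_X: "\<And>f. f \<in> fun_space lebesgue NX \<Longrightarrow> TX f = TXb (rearr lebesgue f)"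
    and a_Y: "\<And>f. f \<in> fun_space lebesgue NY \<Longrightarrow> TY f = TYb (rearr lebesgue f)"
    and b_X: "\<And>\<phi>. \<phi> \<in> fun_space half_line NXb \<Longrightarrow> (\<forall>t>0. 0 \<le> \<phi> t) \<Longrightarrow>
                TXb \<phi> = TXb (rearr half_line \<phi>)"
    and b_Y: "\<And>\<phi>. \<phi> \<in> fun_space half_line NYb \<Longrightarrow> (\<forall>t>0. 0 \<le> \<phi> t) \<Longrightarrow>
                TYb \<phi> = TYb (rearr half_line \<phi>)"
    and c_Y: "\<And>\<phi>1 \<phi>2. \<phi>1 \<in> fun_space half_line NYb \<Longrightarrow> \<phi>2 \<in> fun_space half_line NYb \<Longrightarrow>
                (\<forall>t>0. 0 \<le> \<phi>1 t \<and> \<phi>1 t \<le> \<phi>2 t) \<Longrightarrow> TYb \<phi>1 \<le> TYb \<phi>2"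
    and Omega: "\<Omega> \<in> sets lebesgue"
  shows "(hardy_inequality \<alpha> \<psi> NXb NYb TXb TYb \<Omega> \<longrightarrow> potential_inequality \<alpha> \<psi> NX NY TX TY \<Omega>)
    \<and> (\<Omega> = UNIV \<longrightarrow> potential_inequality \<alpha> \<psi> NX NY TX TY \<Omega> \<longrightarrow>
         hardy_inequality \<alpha> \<psi> NXb NYb TXb TYb \<Omega>)"
proof (intro conjI impI)
  show "potential_inequality \<alpha> \<psi> NX NY TX TY \<Omega>" if "hardy_inequality \<alpha> \<psi> NXb NYb TXb TYb \<Omega>"
    by (rule potential_inequality_if_hardy_inequality[where NXb = NXb and NYb = NYb and TXb = TXb and TYb = TYb];
        fact)
  assume "\<Omega> = UNIV" "potential_inequality \<alpha> \<psi> NX NY TX TY \<Omega>"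
  then have "potential_inequality \<alpha> \<psi> NX NY TX TY UNIV" by simp
  show "hardy_inequality \<alpha> \<psi> NXb NYb TXb TYb \<Omega>"
    by (rule hardy_inequality_if_potential_inequality[where NX = NX and NY = NY and TX = TX and TY = TY]; fact)
qed

end
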